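(* The only weakly indecomposable polytopes are simplices; that is, every $n$-polytope in $\mathbb{R}^n$ which is not an $n$-simplex is weakly decomposable.
   Context: A convex body in $\mathbb{R}^n$ is a convex compact set with non-empty interior. An $n$-polytope is an $n$-dimensional convex hull of a finite set of points in $\mathbb{R}^n$; an $n$-simplex is the convex hull of $n+1$ affinely independent points. With $h_K(u)=\max\{\langle x,u\rangle:x\in K\}$, the surface area measure $S_K$ of a convex body $K$ is the Borel measure on the unit sphere $\mathbb{S}^{n-1}$ given by $S_K(\Omega)=\mathcal{H}^{n-1}\big(\{x\in\partial K:\exists u\in\Omega,\ \langle x,u\rangle=h_K(u)\}\big)$. A convex body $K$ in $\mathbb{R}^n$ is called weakly decomposable if there exists a non-empty compact convex set $M$, not homothetic to $K$, such that $S_{K+M}$ is absolutely continuous with respect to $S_K$, where $K+M$ is the Minkowski sum. A convex body that is not weakly decomposable is called weakly indecomposable. Here $M$ is homothetic to $K$ if $M=\lambda K+x$ for some $\lambda\ge 0$ and $x\in\mathbb{R}^n$ (so single points count as homothetic to $K$). *)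

theory Defs
  imports "HOL-Analysis.Analysis"
begin

(* n-dimensional Euclidean space is a type 'a of class euclidean_space, with n = DIM('a). *)

(* The d-dimensional Hausdorff (outer) measure, normalised so that on a d-dimensional
   Euclidean space it is Lebesgue outer measure. Only integer d is needed. With 0 ^ 0 = 1, the gauge
   gives every non-empty set weight 1 when d = 0, so the case d = 0 is counting measure. Covering
   sets must be bounded because diameter is meaningless on unbounded sets. *)

definition hausdorff_gauge :: "nat \<Rightarrow> 'a::metric_space set \<Rightarrow> ennreal" where
  "hausdorff_gauge d C =
     (if C = {} then 0 else ennreal (unit_ball_vol (real d) * (diameter C / 2) ^ d))"

definition hausdorff_premeasure :: "nat \<Rightarrow> real \<Rightarrow> 'a::metric_space set \<Rightarrow> ennreal" where
  "hausdorff_premeasure d \<delta> A =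
     (INF C\<in>{C :: nat \<Rightarrow> 'a set. A \<subseteq> (\<Union>i. C i) \<and> (\<forall>i. bounded (C i) \<and> diameter (C i) \<le> \<delta>)}.
        \<Sum>i. hausdorff_gauge d (C i))"

definition hausdorff_measure :: "nat \<Rightarrow> 'a::metric_space set \<Rightarrow> ennreal" where
  "hausdorff_measure d A = (SUP \<delta>\<in>{0<..}. hausdorff_premeasure d \<delta> A)"

definition convex_body :: "'a::euclidean_space set \<Rightarrow> bool" where
  "convex_body K \<longleftrightarrow> convex K \<and> compact K \<and> interior K \<noteq> {}"

(* For non-empty compact K the supremum is attained, so it is the maximum. *)
definition support_function :: "'a::euclidean_space set \<Rightarrow> 'a \<Rightarrow> real" where
  "support_function K u = (SUP x\<in>K. x \<bullet> u)"

(* For a convex body K the set function below is countably additive on the Borel subsets of the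
   sphere, as measure_of requires to return it as the emeasure. *)
definition surface_area_measure :: "'a::euclidean_space set \<Rightarrow> 'a measure" where
  "surface_area_measure K =
     measure_of (sphere 0 1) (sets (restrict_space borel (sphere 0 1)))
       (\<lambda>\<Omega>. hausdorff_measure (DIM('a) - 1)
              {x \<in> frontier K. \<exists>u\<in>\<Omega>. x \<bullet> u = support_function K u})"

(* The factor 0 is allowed, so single points are homothetic to every non-empty K. *)
definition homothetic :: "'a::euclidean_space set \<Rightarrow> 'a set \<Rightarrow> bool" where
  "homothetic M K \<longleftrightarrow> (\<exists>c\<ge>0. \<exists>x. M = (\<lambda>y. c *\<^sub>R y + x) ` K)"

(* K + M is the Minkowski sum (Set_Algebras); absolutely_continuous N N' says that N' is absolutely
   continuous with respect to N. *)
definition weakly_decomposable :: "'a::euclidean_space set \<Rightarrow> bool" where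
  "weakly_decomposable K \<longleftrightarrow>
     convex_body K \<and>
     (\<exists>M. M \<noteq> {} \<and> compact M \<and> convex M \<and> \<not> homothetic M K \<and>
          absolutely_continuous (surface_area_measure K) (surface_area_measure (K + M)))"

end

theory Submission
  imports Defs
begin

text \<open>
The surface area measure of a polytope \<open>P\<close> is a sum of point masses, one at each outer unit facet
normal, weighted by the area of that facet. So \<open>S\<^bsub>P+M\<^esub>\<close> is absolutely continuous with respect to
\<open>S\<^bsub>P\<^esub>\<close> as soon as \<open>P + M\<close> is a polytope all of whose facet normals are already facet normals of \<open>P\<close>.
Such an \<open>M\<close> is found as follows. Write \<open>P = {x. x \<bullet> u \<le> h(u) for u \<in> U}\<close> with \<open>U\<close> the set of outer unit
facet normals and \<open>h\<close> the support function. Push one facet, with normal \<open>j\<close>, outwards by a small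
\<open>\<epsilon>\<close> to get \<open>Q = {x. x \<bullet> u \<le> b(u)}\<close>. For small \<open>\<epsilon>\<close> the constraints tight at a point of \<open>Q\<close> are jointly
tight at some point of \<open>P\<close> (\<open>small_perturbation_refines\<close>), that is, the normal fan of \<open>Q\<close> refines
that of \<open>P\<close>. Therefore \<open>P\<close> is a Minkowski summand of every large multiple of \<open>Q\<close>: the complement
\<open>M = {x. x \<bullet> u \<le> l b(u) - h(u)}\<close> satisfies \<open>P + M = l Q\<close> (\<open>summand_if_refines\<close>).

If this \<open>M\<close> is homothetic to \<open>P\<close>, then so is \<open>Q\<close>, and comparing support functions at the normals
shows that the indicator function of \<open>j\<close> on \<open>U\<close> is a linear combination of \<open>h\<close> and the coordinate
functions (\<open>indecomposable_imp_dual_functional\<close>). If this happens for every \<open>j \<in> U\<close>, the vectors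
\<open>(h(u), u)\<close> in a space of dimension \<open>n + 1\<close> are linearly independent, so \<open>P\<close> has at most \<open>n + 1\<close>
facets, and such a polytope is a simplex (\<open>simplex_if_few_normals\<close>).

The measure theory behind the first sentence needs three facts about \<open>(n-1)\<close>-dimensional Hausdorff
measure: facets have positive measure, intersections of two facets have measure zero, and the
measures of distinct facets add up. Additivity is obtained without Caratheodory's criterion: each
facet is shrunk slightly towards a relative interior point, after which the facets are disjoint
compact sets, and disjoint compact sets lie at positive distance from each other.
\<close>

section \<open>Hausdorff measure as an outer measure\<close>

lemma bounded_diameter_le:
  fixes C :: "'a::metric_space set"
  assumes "\<And>x y. x \<in> C \<Longrightarrow> y \<in> C \<Longrightarrow> dist x y \<le> r" "0 \<le> r"
  shows "bounded C" and "diameter C \<le> r"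
proof -
  show "bounded C"
    using assms(1) unfolding bounded_def by blast
  show "diameter C \<le> r"
    unfolding diameter_def using assms by (auto intro!: cSUP_least)
qed

lemma hausdorff_gauge_empty [simp]: "hausdorff_gauge d {} = 0"
  by (simp add: hausdorff_gauge_def)

lemma hausdorff_gauge_le:
  assumes "\<And>x y. x \<in> C \<Longrightarrow> y \<in> C \<Longrightarrow> dist x y \<le> r" "0 \<le> r"
  shows "hausdorff_gauge d C \<le> ennreal (unit_ball_vol (real d) * (r / 2) ^ d)"
  using bounded_diameter_le[OF assms] diameter_ge_0[of C]
  by (auto simp: hausdorff_gauge_def intro!: ennreal_leI mult_left_mono power_mono)

lemma hausdorff_gauge_contraction:
  fixes C :: "'a::metric_space set" and C' :: "'b::metric_space set"
  assumes "bounded C" "0 \<le> L" "C = {} \<Longrightarrow> C' = {}"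
    and dist: "\<And>x y. x \<in> C' \<Longrightarrow> y \<in> C' \<Longrightarrow> dist x y \<le> L * diameter C"
  shows "hausdorff_gauge d C' \<le> ennreal (L ^ d) * hausdorff_gauge d C"
proof (cases "C' = {}")
  case False
  then have "C \<noteq> {}" using assms(3) by blast
  have nn: "0 \<le> diameter C" using \<open>bounded C\<close> by (rule diameter_ge_0)
  have "hausdorff_gauge d C' \<le> ennreal (unit_ball_vol (real d) * (L * diameter C / 2) ^ d)"
    using dist nn \<open>0 \<le> L\<close> by (intro hausdorff_gauge_le) auto
  also have "unit_ball_vol (real d) * (L * diameter C / 2) ^ d
      = L ^ d * (unit_ball_vol (real d) * (diameter C / 2) ^ d)"
    by (simp add: power_mult_distrib power_divide)
  finally show ?thesis
    using \<open>C \<noteq> {}\<close> \<open>0 \<le> L\<close> by (simp add: hausdorff_gauge_def ennreal_mult')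
qed simp

lemma hausdorff_premeasure_le:
  assumes "A \<subseteq> (\<Union>i. C i)" "\<And>i. bounded (C i)" "\<And>i. diameter (C i) \<le> \<delta>"
  shows "hausdorff_premeasure d \<delta> A \<le> (\<Sum>i. hausdorff_gauge d (C i))"
  unfolding hausdorff_premeasure_def using assms by (intro INF_lower) auto

lemma hausdorff_premeasure_ge:
  assumes "\<And>C. A \<subseteq> (\<Union>i. C i) \<Longrightarrow> (\<And>i. bounded (C i)) \<Longrightarrow> (\<And>i. diameter (C i) \<le> \<delta>)
    \<Longrightarrow> x \<le> (\<Sum>i::nat. hausdorff_gauge d (C i))"
  shows "x \<le> hausdorff_premeasure d \<delta> A"
  unfolding hausdorff_premeasure_def by (intro INF_greatest assms) auto

lemma hausdorff_premeasure_cover: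
  assumes "hausdorff_premeasure d \<delta> A < x"
  obtains C :: "nat \<Rightarrow> _" where "A \<subseteq> (\<Union>i. C i)" "\<And>i. bounded (C i)" "\<And>i. diameter (C i) \<le> \<delta>"
    "(\<Sum>i. hausdorff_gauge d (C i)) < x"
  using assms unfolding hausdorff_premeasure_def by (auto simp: INF_less_iff)

lemma hausdorff_premeasure_mono:
  "A \<subseteq> B \<Longrightarrow> hausdorff_premeasure d \<delta> A \<le> hausdorff_premeasure d \<delta> B"
  by (rule hausdorff_premeasure_ge, rule hausdorff_premeasure_le) auto

lemma hausdorff_premeasure_antimono:
  "\<delta> \<le> \<delta>' \<Longrightarrow> hausdorff_premeasure d \<delta>' A \<le> hausdorff_premeasure d \<delta> A"
  by (rule hausdorff_premeasure_ge, rule hausdorff_premeasure_le) (auto intro: order_trans)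

lemma hausdorff_premeasure_le_gauge:
  assumes "bounded A" "diameter A \<le> \<delta>" "0 \<le> \<delta>"
  shows "hausdorff_premeasure d \<delta> A \<le> hausdorff_gauge d A"
proof -
  define C where "C i = (if i = (0::nat) then A else {})" for i
  have "hausdorff_premeasure d \<delta> A \<le> (\<Sum>i. hausdorff_gauge d (C i))"
    using assms by (intro hausdorff_premeasure_le) (auto simp: C_def)
  also have "\<dots> = (\<Sum>i\<in>{0}. hausdorff_gauge d (C i))"
    by (intro suminf_finite) (auto simp: C_def)
  finally show ?thesis by (simp add: C_def)
qed

lemma hausdorff_premeasure_empty [simp]: "0 \<le> \<delta> \<Longrightarrow> hausdorff_premeasure d \<delta> {} = 0"
  using hausdorff_premeasure_le_gauge[of "{}" \<delta> d] by simp

text \<open>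
Merges a cover of \<open>A\<close> and a cover of \<open>B\<close> into one sequence covering the union.
\<close>

lemma suminf_interleave_le:
  fixes f g :: "nat \<Rightarrow> ennreal"
  shows "(\<Sum>i. if even i then f (i div 2) else g (i div 2)) \<le> (\<Sum>i. f i) + (\<Sum>i. g i)"
proof (rule suminf_le_const)
  let ?h = "\<lambda>i. if even i then f (i div 2) else g (i div 2)"
  fix m
  have eq: "sum ?h {..<2 * k} = sum f {..<k} + sum g {..<k}" for k
    by (induction k) (auto simp: algebra_simps)
  have "sum ?h {..<m} \<le> sum ?h {..<2 * m}"
    by (intro sum_mono2) auto
  also have "\<dots> \<le> (\<Sum>i. f i) + (\<Sum>i. g i)"
    unfolding eq by (intro add_mono sum_le_suminf) auto
  finally show "sum ?h {..<m} \<le> (\<Sum>i. f i) + (\<Sum>i. g i)" .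
qed simp

lemma hausdorff_premeasure_Un_le:
  "hausdorff_premeasure d \<delta> (A \<union> B) \<le> hausdorff_premeasure d \<delta> A + hausdorff_premeasure d \<delta> B"
proof (rule ennreal_le_epsilon)
  fix e :: real
  assume fin: "hausdorff_premeasure d \<delta> A + hausdorff_premeasure d \<delta> B < top" and "0 < e"
  have "hausdorff_premeasure d \<delta> A < hausdorff_premeasure d \<delta> A + ennreal (e/2)"
    "hausdorff_premeasure d \<delta> B < hausdorff_premeasure d \<delta> B + ennreal (e/2)"
    using fin \<open>0 < e\<close> by (auto simp: ennreal_add_left_cancel_less less_top)
  then obtain C D where
    C: "A \<subseteq> (\<Union>i::nat. C i)" "\<And>i. bounded (C i)" "\<And>i. diameter (C i) \<le> \<delta>"
      "(\<Sum>i. hausdorff_gauge d (C i)) < hausdorff_premeasure d \<delta> A + ennreal (e/2)" and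
    D: "B \<subseteq> (\<Union>i::nat. D i)" "\<And>i. bounded (D i)" "\<And>i. diameter (D i) \<le> \<delta>"
      "(\<Sum>i. hausdorff_gauge d (D i)) < hausdorff_premeasure d \<delta> B + ennreal (e/2)"
    by (elim hausdorff_premeasure_cover) blast
  define E where "E i = (if even i then C (i div 2) else D (i div 2))" for i
  have "C i \<subseteq> (\<Union>i. E i)" "D i \<subseteq> (\<Union>i. E i)" for i
    using UN_upper[of "2 * i" UNIV E] UN_upper[of "2 * i + 1" UNIV E] by (simp_all add: E_def)
  then have "(\<Union>i. C i) \<subseteq> (\<Union>i. E i)" "(\<Union>i. D i) \<subseteq> (\<Union>i. E i)"
    by (simp_all only: UN_least)
  then have "A \<union> B \<subseteq> (\<Union>i. E i)"
    by (intro Un_least subset_trans[OF C(1)] subset_trans[OF D(1)])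
  then have "hausdorff_premeasure d \<delta> (A \<union> B) \<le> (\<Sum>i. hausdorff_gauge d (E i))"
    by (rule hausdorff_premeasure_le) (auto simp: E_def C D)
  also have "\<dots> = (\<Sum>i. if even i then hausdorff_gauge d (C (i div 2)) else hausdorff_gauge d (D (i div 2)))"
    by (intro suminf_cong) (auto simp: E_def)
  also have "\<dots> \<le> (\<Sum>i. hausdorff_gauge d (C i)) + (\<Sum>i. hausdorff_gauge d (D i))"
    by (rule suminf_interleave_le)
  also have "\<dots> \<le> (hausdorff_premeasure d \<delta> A + ennreal (e/2)) + (hausdorff_premeasure d \<delta> B + ennreal (e/2))"
    using C(4) D(4) by (intro add_mono) auto
  also have "\<dots> = hausdorff_premeasure d \<delta> A + hausdorff_premeasure d \<delta> B + (ennreal (e/2) + ennreal (e/2))"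
    by (simp add: algebra_simps)
  also have "ennreal (e/2) + ennreal (e/2) = ennreal e"
    using \<open>0 < e\<close> by (subst ennreal_plus[symmetric]) auto
  finally show "hausdorff_premeasure d \<delta> (A \<union> B)
    \<le> hausdorff_premeasure d \<delta> A + hausdorff_premeasure d \<delta> B + ennreal e" .
qed

lemma hausdorff_premeasure_UN_le:
  assumes "finite I" "0 \<le> \<delta>"
  shows "hausdorff_premeasure d \<delta> (\<Union>i\<in>I. A i) \<le> (\<Sum>i\<in>I. hausdorff_premeasure d \<delta> (A i))"
  using assms(1)
proof (induction I rule: finite_induct)
  case (insert i I)
  then show ?case
    using hausdorff_premeasure_Un_le[of d \<delta> "A i" "\<Union>i\<in>I. A i"]
    by (auto intro: order_trans add_left_mono)
qed (simp add: assms)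

text \<open>
A set of diameter at most \<open>\<delta> < r\<close> cannot meet both \<open>A\<close> and \<open>B\<close>, so every cover of the union splits into
a cover of \<open>A\<close> and a cover of \<open>B\<close> without increasing the sum of the gauges.
\<close>

lemma hausdorff_premeasure_Un_separated:
  assumes sep: "\<And>a b. a \<in> A \<Longrightarrow> b \<in> B \<Longrightarrow> r \<le> dist a b" and "\<delta> < r"
  shows "hausdorff_premeasure d \<delta> A + hausdorff_premeasure d \<delta> B \<le> hausdorff_premeasure d \<delta> (A \<union> B)"
proof (rule hausdorff_premeasure_ge)
  fix C :: "nat \<Rightarrow> _"
  assume C: "A \<union> B \<subseteq> (\<Union>i. C i)" "\<And>i. bounded (C i)" "\<And>i. diameter (C i) \<le> \<delta>"
  have bd: "bounded (C i \<inter> X)" for i X using C(2) by (metis bounded_Int)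
  have dm: "diameter (C i \<inter> X) \<le> \<delta>" for i X
    using diameter_subset[of "C i \<inter> X" "C i"] C(2,3)[of i] by (meson inf_le1 order_trans)
  have "hausdorff_gauge d (C i \<inter> A) + hausdorff_gauge d (C i \<inter> B) \<le> hausdorff_gauge d (C i)" for i
  proof -
    have le: "hausdorff_gauge d (C i \<inter> X) \<le> hausdorff_gauge d (C i)" for X
      using hausdorff_gauge_contraction[of "C i" 1 "C i \<inter> X" d] C(2)[of i]
      by (auto simp: diameter_bounded_bound)
    have "C i \<inter> A = {} \<or> C i \<inter> B = {}"
    proof (rule ccontr)
      assume "\<not> ?thesis"
      then obtain a b where "a \<in> C i" "a \<in> A" "b \<in> C i" "b \<in> B" by auto
      then show False
        using sep[of a b] diameter_bounded_bound[OF C(2)[of i], of a b] C(3)[of i] \<open>\<delta> < r\<close> by simp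
    qed
    then show ?thesis using le[of A] le[of B] by auto
  qed
  then have "(\<Sum>i. hausdorff_gauge d (C i \<inter> A) + hausdorff_gauge d (C i \<inter> B)) \<le> (\<Sum>i. hausdorff_gauge d (C i))"
    by (intro suminf_le) auto
  then have "(\<Sum>i. hausdorff_gauge d (C i \<inter> A)) + (\<Sum>i. hausdorff_gauge d (C i \<inter> B)) \<le> (\<Sum>i. hausdorff_gauge d (C i))"
    by (subst suminf_add) auto
  moreover have "hausdorff_premeasure d \<delta> A \<le> (\<Sum>i. hausdorff_gauge d (C i \<inter> A))"
    using C(1) bd dm by (intro hausdorff_premeasure_le) auto
  moreover have "hausdorff_premeasure d \<delta> B \<le> (\<Sum>i. hausdorff_gauge d (C i \<inter> B))"
    using C(1) bd dm by (intro hausdorff_premeasure_le) auto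
  ultimately show "hausdorff_premeasure d \<delta> A + hausdorff_premeasure d \<delta> B \<le> (\<Sum>i. hausdorff_gauge d (C i))"
    by (meson add_mono order_trans)
qed

lemma hausdorff_premeasure_le_measure:
  "0 < \<delta> \<Longrightarrow> hausdorff_premeasure d \<delta> A \<le> hausdorff_measure d A"
  unfolding hausdorff_measure_def by (intro SUP_upper) auto

lemma hausdorff_measure_leI:
  "(\<And>\<delta>. 0 < \<delta> \<Longrightarrow> hausdorff_premeasure d \<delta> A \<le> x) \<Longrightarrow> hausdorff_measure d A \<le> x"
  unfolding hausdorff_measure_def by (intro SUP_least) auto

lemma hausdorff_measure_mono:
  "A \<subseteq> B \<Longrightarrow> hausdorff_measure d A \<le> hausdorff_measure d B"
  unfolding hausdorff_measure_def by (intro SUP_mono) (auto intro: hausdorff_premeasure_mono)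

lemma hausdorff_measure_empty [simp]: "hausdorff_measure d {} = 0"
  by (metis hausdorff_measure_leI hausdorff_premeasure_empty less_imp_le order_refl le_zero_eq)

lemma hausdorff_measure_Un_le:
  "hausdorff_measure d (A \<union> B) \<le> hausdorff_measure d A + hausdorff_measure d B"
  by (intro hausdorff_measure_leI order_trans[OF hausdorff_premeasure_Un_le] add_mono
      hausdorff_premeasure_le_measure)

lemma hausdorff_measure_UN_le:
  assumes "finite I"
  shows "hausdorff_measure d (\<Union>i\<in>I. A i) \<le> (\<Sum>i\<in>I. hausdorff_measure d (A i))"
  using assms
proof (induction I rule: finite_induct)
  case (insert i I)
  then show ?case
    using hausdorff_measure_Un_le[of d "A i" "\<Union>i\<in>I. A i"]
    by (auto intro: order_trans add_left_mono)
qed simp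

lemma hausdorff_measure_Un_separated:
  assumes sep: "\<And>a b. a \<in> A \<Longrightarrow> b \<in> B \<Longrightarrow> r \<le> dist a b" and "0 < r"
  shows "hausdorff_measure d A + hausdorff_measure d B \<le> hausdorff_measure d (A \<union> B)"
proof -
  let ?p = "hausdorff_premeasure d"
  have "hausdorff_measure d A + hausdorff_measure d B = (SUP \<delta>\<in>{0<..}. ?p \<delta> A + ?p \<delta> B)"
    unfolding hausdorff_measure_def
  proof (rule SUP_add_directed_ennreal[symmetric])
    fix i j :: real assume "i \<in> {0<..}" "j \<in> {0<..}"
    then show "\<exists>k\<in>{0<..}. ?p i A + ?p j B \<le> ?p k A + ?p k B"
      by (intro bexI[of _ "min i j"] add_mono hausdorff_premeasure_antimono) auto
  qed
  also have "\<dots> \<le> hausdorff_measure d (A \<union> B)"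
  proof (rule SUP_least)
    fix \<delta> :: real assume "\<delta> \<in> {0<..}"
    define \<delta>' where "\<delta>' = min \<delta> (r/2)"
    have "0 < \<delta>'" "\<delta>' < r" "\<delta>' \<le> \<delta>"
      using \<open>\<delta> \<in> {0<..}\<close> \<open>0 < r\<close> by (auto simp: \<delta>'_def)
    have "?p \<delta> A + ?p \<delta> B \<le> ?p \<delta>' A + ?p \<delta>' B"
      by (intro add_mono hausdorff_premeasure_antimono \<open>\<delta>' \<le> \<delta>\<close>)
    also have "\<dots> \<le> ?p \<delta>' (A \<union> B)"
      using sep \<open>\<delta>' < r\<close> by (rule hausdorff_premeasure_Un_separated)
    also have "\<dots> \<le> hausdorff_measure d (A \<union> B)"
      using \<open>0 < \<delta>'\<close> by (rule hausdorff_premeasure_le_measure)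
    finally show "?p \<delta> A + ?p \<delta> B \<le> hausdorff_measure d (A \<union> B)" .
  qed
  finally show ?thesis .
qed

text \<open>
Disjoint compact sets have positive distance, so this follows from the separated case by induction.
\<close>

lemma hausdorff_measure_disjoint_compact:
  fixes A :: "'i \<Rightarrow> 'a::heine_borel set"
  assumes "finite I" "\<And>i. i \<in> I \<Longrightarrow> compact (A i)" "disjoint_family_on A I"
  shows "(\<Sum>i\<in>I. hausdorff_measure d (A i)) \<le> hausdorff_measure d (\<Union>i\<in>I. A i)"
  using assms
proof (induction I rule: finite_induct)
  case (insert i I)
  have "compact (A i)" "closed (\<Union>i\<in>I. A i)"
    using insert by (auto intro: compact_imp_closed)
  moreover have "A i \<inter> (\<Union>i\<in>I. A i) = {}"
    using insert(2,5) by (auto simp: disjoint_family_on_def)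
  ultimately obtain r where "0 < r" "\<And>a b. a \<in> A i \<Longrightarrow> b \<in> (\<Union>i\<in>I. A i) \<Longrightarrow> r \<le> dist a b"
    by (metis separate_compact_closed)
  then have "hausdorff_measure d (A i) + hausdorff_measure d (\<Union>i\<in>I. A i)
      \<le> hausdorff_measure d (A i \<union> (\<Union>i\<in>I. A i))"
    by (intro hausdorff_measure_Un_separated)
  moreover have "(\<Sum>i\<in>I. hausdorff_measure d (A i)) \<le> hausdorff_measure d (\<Union>i\<in>I. A i)"
    using insert by (auto simp: disjoint_family_on_def)
  ultimately show ?case
    using insert(1,2) by (auto intro: order_trans add_left_mono)
qed simp

text \<open>
Images of the sets of a cover cover the image, with diameters multiplied by at most \<open>L\<close>. The sets are
intersected with \<open>A\<close> first because \<open>f\<close> is controlled only there.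
\<close>

lemma hausdorff_measure_lipschitz_image:
  fixes f :: "'a::metric_space \<Rightarrow> 'b::metric_space"
  assumes lip: "\<And>x y. x \<in> A \<Longrightarrow> y \<in> A \<Longrightarrow> dist (f x) (f y) \<le> L * dist x y" and "0 < L"
  shows "hausdorff_measure d (f ` A) \<le> ennreal (L ^ d) * hausdorff_measure d A"
proof (rule hausdorff_measure_leI)
  fix \<delta> :: real assume "0 < \<delta>"
  let ?c = "ennreal (L ^ d)"
  have c: "0 < ?c" using \<open>0 < L\<close> by simp
  have "hausdorff_premeasure d \<delta> (f ` A) / ?c \<le> hausdorff_premeasure d (\<delta> / L) A"
  proof (rule hausdorff_premeasure_ge)
    fix C :: "nat \<Rightarrow> _"
    assume C: "A \<subseteq> (\<Union>i. C i)" "\<And>i. bounded (C i)" "\<And>i. diameter (C i) \<le> \<delta> / L"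
    have dist: "dist x y \<le> L * diameter (C i)" if xy: "x \<in> f ` (C i \<inter> A)" "y \<in> f ` (C i \<inter> A)" for x y i
    proof -
      obtain a b where "a \<in> C i" "b \<in> C i" "a \<in> A" "b \<in> A" "x = f a" "y = f b"
        using xy by blast
      then show ?thesis
        using lip[of a b] diameter_bounded_bound[OF C(2)[of i], of a b] \<open>0 < L\<close>
        by (meson less_imp_le mult_left_mono order_trans)
    qed
    have *: "bounded (f ` (C i \<inter> A))" "diameter (f ` (C i \<inter> A)) \<le> \<delta>" for i
    proof -
      have "L * diameter (C i) \<le> \<delta>" using C(3)[of i] \<open>0 < L\<close> by (simp add: field_simps)
      then have "dist x y \<le> \<delta>" if "x \<in> f ` (C i \<inter> A)" "y \<in> f ` (C i \<inter> A)" for x y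
        using dist[OF that] by linarith
      then show "bounded (f ` (C i \<inter> A))" "diameter (f ` (C i \<inter> A)) \<le> \<delta>"
        using bounded_diameter_le[of "f ` (C i \<inter> A)" \<delta>] \<open>0 < \<delta>\<close> by auto
    qed
    have "f ` A \<subseteq> (\<Union>i. f ` (C i \<inter> A))"
      using C(1) by blast
    then have "hausdorff_premeasure d \<delta> (f ` A) \<le> (\<Sum>i. hausdorff_gauge d (f ` (C i \<inter> A)))"
      using * by (intro hausdorff_premeasure_le) auto
    also have "\<dots> \<le> (\<Sum>i. ?c * hausdorff_gauge d (C i))"
      using C(2) \<open>0 < L\<close> dist by (intro suminf_le hausdorff_gauge_contraction) auto
    also have "\<dots> = ?c * (\<Sum>i. hausdorff_gauge d (C i))" by simp
    finally show "hausdorff_premeasure d \<delta> (f ` A) / ?c \<le> (\<Sum>i. hausdorff_gauge d (C i))"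
      by (rule divide_le_posI_ennreal[OF c])
  qed
  also have "\<dots> \<le> hausdorff_measure d A"
    using \<open>0 < \<delta>\<close> \<open>0 < L\<close> by (intro hausdorff_premeasure_le_measure) auto
  finally have le: "?c * (hausdorff_premeasure d \<delta> (f ` A) / ?c) \<le> ?c * hausdorff_measure d A"
    by (rule mult_left_mono) simp
  have "?c * (hausdorff_premeasure d \<delta> (f ` A) / ?c) = hausdorff_premeasure d \<delta> (f ` A)"
    using c by (metis ennreal_mult_divide_eq ennreal_neq_top ennreal_times_divide mult.commute
        not_gr_zero)
  with le show "hausdorff_premeasure d \<delta> (f ` A) \<le> ?c * hausdorff_measure d A" by simp
qed

section \<open>Hausdorff measure inside hyperplanes\<close>

text \<open>
Cut the box into \<open>k^d\<close> cells of side \<open>2R/k\<close>, with \<open>d = n - 1\<close> since the coordinate \<open>e\<close> is constant.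
The cells have diameter at most \<open>2dR/k\<close>, so the sum of the gauges is bounded independently of \<open>k\<close>.
\<close>

lemma hausdorff_measure_coordinate_box_finite:
  fixes e :: "'a::euclidean_space"
  assumes "e \<in> Basis" "0 < R"
  shows "hausdorff_measure (DIM('a) - 1) {x::'a. x \<bullet> e = 0 \<and> (\<forall>b\<in>Basis. - R \<le> x \<bullet> b \<and> x \<bullet> b < R)} < \<infinity>"
    (is "hausdorff_measure ?d ?B < _")
proof -
  define D :: "'a set" where "D = Basis - {e}"
  have D: "finite D" "card D = ?d" using assms by (auto simp: D_def)
  define W where "W = unit_ball_vol (real ?d) * (real ?d * R) ^ ?d"
  have "hausdorff_measure ?d ?B \<le> ennreal W"
  proof (rule hausdorff_measure_leI)
    fix \<delta> :: real assume "0 < \<delta>"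
    obtain k :: nat where k: "real ?d * (2 * R) / \<delta> < real k" "0 < k"
      using \<open>0 < R\<close> \<open>0 < \<delta>\<close>
      by (metis reals_Archimedean2 divide_nonneg_pos gr0I less_imp_le mult_nonneg_nonneg
          not_le of_nat_0 of_nat_0_le_iff zero_le_numeral)
    define r where "r = real ?d * (2 * R / real k)"
    have r: "0 \<le> r" "r \<le> \<delta>"
      using k \<open>0 < \<delta>\<close> \<open>0 < R\<close> by (auto simp: r_def field_simps)
    \<comment> \<open>The box is half-open, so the cell index of a point always stays below \<open>k\<close>.\<close>
    define cell where "cell x b = nat \<lfloor>(x \<bullet> b + R) * (real k / (2 * R))\<rfloor>" for x b :: 'a
    define C where "C g = {x \<in> ?B. \<forall>b\<in>D. cell x b = g b}" for g
    define G where "G = PiE D (\<lambda>_. {..<k})"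
    have G: "finite G" "card G = k ^ ?d"
      using D by (auto simp: G_def finite_PiE card_PiE)
    have cover: "?B \<subseteq> (\<Union>g\<in>G. C g)"
    proof
      fix x assume x: "x \<in> ?B"
      have "cell x b < k" if "b \<in> D" for b
      proof -
        have "0 \<le> x \<bullet> b + R" "x \<bullet> b + R < 2 * R" using x that by (auto simp: D_def)
        then have "(x \<bullet> b + R) * (real k / (2 * R)) < real k"
          using k(2) \<open>0 < R\<close> by (simp add: field_simps)
        then show ?thesis
          using k(2) unfolding cell_def by linarith
      qed
      then have "restrict (cell x) D \<in> G" "x \<in> C (restrict (cell x) D)"
        using x by (auto simp: G_def C_def)
      then show "x \<in> (\<Union>g\<in>G. C g)" by blast
    qed
    have dist: "dist x y \<le> r" if "x \<in> C g" "y \<in> C g" for x y g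
    proof -
      have c: "\<bar>(x - y) \<bullet> b\<bar> \<le> 2 * R / real k" if "b \<in> D" for b
      proof -
        have "cell x b = cell y b" "0 \<le> x \<bullet> b + R" "0 \<le> y \<bullet> b + R"
          using that \<open>x \<in> C g\<close> \<open>y \<in> C g\<close> by (auto simp: C_def D_def)
        then have "\<lfloor>(x \<bullet> b + R) * (real k / (2 * R))\<rfloor> = \<lfloor>(y \<bullet> b + R) * (real k / (2 * R))\<rfloor>"
          using \<open>0 < R\<close> by (simp add: cell_def nat_eq_iff2 split: if_splits)
        then have "\<bar>(x \<bullet> b + R) * (real k / (2 * R)) - (y \<bullet> b + R) * (real k / (2 * R))\<bar> \<le> 1"
          by linarith
        also have "(x \<bullet> b + R) * (real k / (2 * R)) - (y \<bullet> b + R) * (real k / (2 * R)) = ((x - y) \<bullet> b) * (real k / (2 * R))"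
          by (simp only: inner_diff_left left_diff_distrib[symmetric] add_diff_cancel_right)
        finally show ?thesis
          using k(2) \<open>0 < R\<close> by (simp add: abs_mult field_simps)
      qed
      have "dist x y \<le> (\<Sum>b\<in>Basis. \<bar>(x - y) \<bullet> b\<bar>)"
        unfolding dist_norm by (rule norm_le_l1)
      also have "\<dots> = (\<Sum>b\<in>D. \<bar>(x - y) \<bullet> b\<bar>)"
        using that assms(1) unfolding D_def
        by (intro sum.mono_neutral_right) (auto simp: C_def inner_diff_left)
      also have "\<dots> \<le> r"
        using sum_mono[of D, OF c] D by (simp add: r_def)
      finally show ?thesis .
    qed
    have gauge: "hausdorff_gauge ?d (C g) \<le> ennreal (unit_ball_vol (real ?d) * (r / 2) ^ ?d)"
      and "bounded (C g)" and "diameter (C g) \<le> r" for g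
      by (rule hausdorff_gauge_le bounded_diameter_le; use dist \<open>0 \<le> r\<close> in blast)+
    have "hausdorff_premeasure ?d \<delta> ?B \<le> hausdorff_premeasure ?d \<delta> (\<Union>g\<in>G. C g)"
      by (rule hausdorff_premeasure_mono[OF cover])
    also have "\<dots> \<le> (\<Sum>g\<in>G. hausdorff_premeasure ?d \<delta> (C g))"
      using G \<open>0 < \<delta>\<close> by (intro hausdorff_premeasure_UN_le) auto
    also have "\<dots> \<le> (\<Sum>g\<in>G. ennreal (unit_ball_vol (real ?d) * (r / 2) ^ ?d))"
    proof (rule sum_mono)
      fix g
      have "hausdorff_premeasure ?d \<delta> (C g) \<le> hausdorff_gauge ?d (C g)"
        using \<open>bounded (C g)\<close> \<open>diameter (C g) \<le> r\<close> r \<open>0 < \<delta>\<close>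
        by (intro hausdorff_premeasure_le_gauge) auto
      then show "hausdorff_premeasure ?d \<delta> (C g) \<le> ennreal (unit_ball_vol (real ?d) * (r / 2) ^ ?d)"
        using gauge order_trans by blast
    qed
    also have "\<dots> = ennreal (real (card G) * (unit_ball_vol (real ?d) * (r / 2) ^ ?d))"
      using r by (simp add: ennreal_mult' ennreal_of_nat_eq_real_of_nat)
    also have "real (card G) * (unit_ball_vol (real ?d) * (r / 2) ^ ?d) = W"
      using k(2) by (simp add: G W_def r_def power_mult_distrib power_divide)
    finally show "hausdorff_premeasure ?d \<delta> ?B \<le> ennreal W" .
  qed
  then show ?thesis using le_less_trans by fastforce
qed

text \<open>
A hyperplane whose normal \<open>u\<close> satisfies \<open>u \<bullet> e \<noteq> 0\<close> is a graph over the coordinate hyperplane orthogonal to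
\<open>e\<close>, hence a Lipschitz image of it.
\<close>

lemma hausdorff_measure_hyperplane_ball_finite:
  fixes u :: "'a::euclidean_space"
  assumes "u \<noteq> 0" "0 < R"
  shows "hausdorff_measure (DIM('a) - 1) ({x. x \<bullet> u = c} \<inter> ball 0 R) < \<infinity>"
proof -
  obtain e :: 'a where e: "e \<in> Basis" "u \<bullet> e \<noteq> 0"
    using assms(1) by (meson euclidean_all_zero_iff)
  define B where "B = {x::'a. x \<bullet> e = 0 \<and> (\<forall>b\<in>Basis. - R \<le> x \<bullet> b \<and> x \<bullet> b < R)}"
  define f where "f x = x + ((c - x \<bullet> u) / (u \<bullet> e)) *\<^sub>R e" for x
  define L where "L = 1 + norm u / \<bar>u \<bullet> e\<bar>"
  have "0 < L" by (simp add: L_def add_pos_nonneg)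
  have lip: "dist (f x) (f y) \<le> L * dist x y" for x y
  proof -
    have "f x - f y = (x - y) - (((x - y) \<bullet> u) / (u \<bullet> e)) *\<^sub>R e"
      by (simp add: f_def inner_diff_left diff_divide_distrib scaleR_diff_left algebra_simps)
    then have "norm (f x - f y) \<le> norm (x - y) + norm ((((x - y) \<bullet> u) / (u \<bullet> e)) *\<^sub>R e)"
      by (metis norm_triangle_ineq4)
    also have "\<dots> = norm (x - y) + \<bar>(x - y) \<bullet> u\<bar> / \<bar>u \<bullet> e\<bar>"
      using e by simp
    also have "\<dots> \<le> norm (x - y) + (norm (x - y) * norm u) / \<bar>u \<bullet> e\<bar>"
      by (intro add_left_mono divide_right_mono Cauchy_Schwarz_ineq2) auto
    also have "\<dots> = L * norm (x - y)" by (simp add: L_def algebra_simps)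
    finally show ?thesis by (simp add: dist_norm)
  qed
  have "{x. x \<bullet> u = c} \<inter> ball 0 R \<subseteq> f ` B"
  proof
    fix x assume x: "x \<in> {x. x \<bullet> u = c} \<inter> ball 0 R"
    define y where "y = x - (x \<bullet> e) *\<^sub>R e"
    have yb: "y \<bullet> b = (if b = e then 0 else x \<bullet> b)" if "b \<in> Basis" for b
      using that e by (simp add: y_def inner_diff_left inner_Basis)
    have "\<bar>x \<bullet> b\<bar> < R" if "b \<in> Basis" for b
      using x Basis_le_norm[OF that, of x] by simp
    then have "- R \<le> y \<bullet> b \<and> y \<bullet> b < R" if "b \<in> Basis" for b
      using yb[OF that] that \<open>0 < R\<close> by (force simp: abs_less_iff)
    then have "y \<in> B" using yb[OF e(1)] by (simp add: B_def)
    moreover have "f y = x"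
      using x e by (simp add: f_def y_def inner_diff_left inner_commute[of e u])
    ultimately show "x \<in> f ` B" by blast
  qed
  then have "hausdorff_measure (DIM('a) - 1) ({x. x \<bullet> u = c} \<inter> ball 0 R) \<le> hausdorff_measure (DIM('a) - 1) (f ` B)"
    by (rule hausdorff_measure_mono)
  also have "\<dots> \<le> ennreal (L ^ (DIM('a) - 1)) * hausdorff_measure (DIM('a) - 1) B"
    using lip \<open>0 < L\<close> by (rule hausdorff_measure_lipschitz_image)
  also have "\<dots> < \<infinity>"
    using hausdorff_measure_coordinate_box_finite[OF e(1) \<open>0 < R\<close>]
    by (simp add: B_def ennreal_mult_less_top less_top)
  finally show ?thesis .
qed

text \<open>
Inside the hyperplane \<open>{x. x \<bullet> u = c}\<close> the translates of \<open>G\<close> along \<open>z\<close> are disjoint because they lie in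
different hyperplanes orthogonal to \<open>w\<close>. Arbitrarily many of them fit into one bounded piece of the
hyperplane, which has finite measure, so each has measure zero.
\<close>

lemma hausdorff_measure_codim2_null:
  fixes G :: "'a::euclidean_space set"
  assumes "compact G" and G: "G \<subseteq> {x. x \<bullet> u = c \<and> x \<bullet> w = c'}"
    and "u \<noteq> 0" and z: "z \<bullet> u = 0" "z \<bullet> w \<noteq> 0"
  shows "hausdorff_measure (DIM('a) - 1) G = 0"
proof -
  let ?H = "hausdorff_measure (DIM('a) - 1)"
  obtain r where r: "0 < r" "\<And>x. x \<in> G \<Longrightarrow> norm x \<le> r"
    using compact_imp_bounded[OF \<open>compact G\<close>] by (auto simp: bounded_pos)
  define R where "R = r + norm z + 1"
  have "0 < R" using r by (simp add: R_def add_pos_nonneg)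
  define B where "B = ?H ({x. x \<bullet> u = c} \<inter> ball 0 R)"
  have B: "B < \<infinity>"
    unfolding B_def by (rule hausdorff_measure_hyperplane_ball_finite) fact+
  have "of_nat k * ?H G \<le> B" for k :: nat
  proof (cases "k = 0")
    case False
    define f where "f i x = x + (real i / real k) *\<^sub>R z" for i x
    have "?H G \<le> ?H (f i ` G)" for i
    proof -
      have "?H ((\<lambda>x. x - (real i / real k) *\<^sub>R z) ` f i ` G) \<le> ennreal (1 ^ (DIM('a) - 1)) * ?H (f i ` G)"
        by (intro hausdorff_measure_lipschitz_image) (auto simp: dist_norm)
      then show ?thesis by (simp add: image_image f_def)
    qed
    then have "of_nat k * ?H G \<le> (\<Sum>i<k. ?H (f i ` G))"
      using sum_mono[of "{..<k}" "\<lambda>_. ?H G" "\<lambda>i. ?H (f i ` G)"] by simp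
    also have "\<dots> \<le> ?H (\<Union>i<k. f i ` G)"
    proof (rule hausdorff_measure_disjoint_compact)
      show "compact (f i ` G)" for i
        unfolding f_def by (intro compact_continuous_image continuous_intros \<open>compact G\<close>)
      show "disjoint_family_on (\<lambda>i. f i ` G) {..<k}"
        unfolding disjoint_family_on_def
      proof (intro ballI impI, rule ccontr)
        fix i j assume "i \<noteq> j" "f i ` G \<inter> f j ` G \<noteq> {}"
        then obtain x y where "x \<in> G" "y \<in> G" "f i x = f j y" by blast
        then have "f i x \<bullet> w = f j y \<bullet> w" "x \<bullet> w = c'" "y \<bullet> w = c'" using G by auto
        then have "real i / real k = real j / real k" using z by (simp add: f_def inner_add_left)
        then show False using \<open>i \<noteq> j\<close> \<open>k \<noteq> 0\<close> by simp
      qed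
    qed simp
    also have "\<dots> \<le> B"
      unfolding B_def
    proof (intro hausdorff_measure_mono subsetI)
      fix p assume "p \<in> (\<Union>i<k. f i ` G)"
      then obtain i x where i: "i < k" "x \<in> G" "p = f i x" by blast
      have "norm p \<le> norm x + real i / real k * norm z"
        unfolding i f_def by (rule norm_triangle_le) simp
      also have "\<dots> \<le> r + 1 * norm z"
        using i r by (intro add_mono mult_right_mono) auto
      finally show "p \<in> {x. x \<bullet> u = c} \<inter> ball 0 R"
        using i G z by (auto simp: R_def f_def inner_add_left)
    qed
    finally show ?thesis .
  qed simp
  then have le: "of_nat k * ?H G \<le> B" for k .
  show ?thesis
  proof (rule ccontr)
    assume "?H G \<noteq> 0"
    obtain b where b: "B = ennreal b" "0 \<le> b" using B by (cases B) auto
    have "?H G < \<infinity>" using le[of 1] B by simp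
    then obtain h where h: "?H G = ennreal h" "0 < h" using \<open>?H G \<noteq> 0\<close> by (cases "?H G") (auto simp: less_le)
    obtain k :: nat where "b / h < real k" using reals_Archimedean2 by blast
    then have "b < real k * h" using h by (simp add: field_simps)
    moreover have "ennreal (real k * h) \<le> ennreal b"
      using le[of k] b h by (simp add: ennreal_mult' ennreal_of_nat_eq_real_of_nat)
    ultimately show False using b by (simp add: ennreal_le_iff)
  qed
qed

text \<open>
Compare with Lebesgue measure: the cylinder with base \<open>F = V \<inter> {x. x \<bullet> u = c}\<close> and unit height in a
coordinate direction \<open>e\<close> transversal to the hyperplane contains the non-empty open set \<open>W\<close> below. A set
of diameter \<open>d \<le> 1\<close> covering part of \<open>F\<close> sweeps out part of a box with sides \<open>2d\<close>, except for one side
\<open>2d + 1 \<le> 3\<close>, so the volume of \<open>W\<close> is at most a constant times the sum of the gauges.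
\<close>

lemma hausdorff_measure_relopen_hyperplane_pos:
  fixes u :: "'a::euclidean_space"
  assumes "u \<noteq> 0" "open V" "p \<in> V" "p \<bullet> u = c"
  shows "0 < hausdorff_measure (DIM('a) - 1) (V \<inter> {x. x \<bullet> u = c})"
proof (rule ccontr)
  let ?d = "DIM('a) - 1" and ?F = "V \<inter> {x. x \<bullet> u = c}"
  assume "\<not> 0 < hausdorff_measure ?d ?F"
  then have null: "hausdorff_premeasure ?d 1 ?F = 0"
    using hausdorff_premeasure_le_measure[of 1 ?d ?F] by simp
  obtain e :: 'a where e: "e \<in> Basis" "u \<bullet> e \<noteq> 0"
    using assms(1) by (meson euclidean_all_zero_iff)
  \<comment> \<open>\<open>s x\<close> is the height of \<open>x\<close> over the hyperplane, measured along \<open>e\<close>.\<close>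
  define s where "s x = (x \<bullet> u - c) / (u \<bullet> e)" for x
  define W where "W = {x. 0 < s x} \<inter> {x. s x < 1} \<inter> (\<lambda>x. x - s x *\<^sub>R e) -` V"
  have cont: "continuous_on UNIV s"
    unfolding s_def using e by (intro continuous_intros) auto
  have "open W"
    unfolding W_def using cont \<open>open V\<close>
    by (intro open_Int open_Collect_less open_vimage continuous_intros)
  have se: "s (p + (1/2) *\<^sub>R e) = 1/2"
    using e \<open>p \<bullet> u = c\<close> by (simp add: s_def inner_add_left inner_commute[of e u])
  have "p + (1/2) *\<^sub>R e \<in> W"
    using \<open>p \<in> V\<close> by (simp add: W_def se)
  have proj: "x - s x *\<^sub>R e \<in> ?F" if "x \<in> W" for x
    using that e by (simp add: W_def s_def inner_diff_left inner_commute[of e u])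
  define \<omega> where "\<omega> = unit_ball_vol (real ?d)"
  have "0 < \<omega>" by (simp add: \<omega>_def)
  define K where "K = 3 * 4 ^ ?d / \<omega>"
  have "0 < K" using \<open>0 < \<omega>\<close> by (simp add: K_def)
  have "emeasure lborel W \<le> 0 + ennreal \<epsilon>" if "0 < \<epsilon>" for \<epsilon>
  proof -
    have "hausdorff_premeasure ?d 1 ?F < ennreal (\<epsilon> / K)"
      using null \<open>0 < \<epsilon>\<close> \<open>0 < K\<close> by simp
    then obtain C :: "nat \<Rightarrow> 'a set" where C: "?F \<subseteq> (\<Union>i. C i)" "\<And>i. bounded (C i)"
      "\<And>i. diameter (C i) \<le> 1" "(\<Sum>i. hausdorff_gauge ?d (C i)) < ennreal (\<epsilon> / K)"
      by (rule hausdorff_premeasure_cover) blast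
    define d where "d i = diameter (C i)" for i
    define q where "q i = (SOME x. x \<in> C i)" for i
    define box where "box i = (if C i = {} then {} else
      cbox (q i - d i *\<^sub>R One) (q i + d i *\<^sub>R One + e))" for i
    have d: "0 \<le> d i" "d i \<le> 1" for i
      using C diameter_ge_0[of "C i"] by (auto simp: d_def)
    have vol: "emeasure lborel (box i) \<le> ennreal K * hausdorff_gauge ?d (C i)" for i
    proof (cases "C i = {}")
      case False
      have side: "((q i + d i *\<^sub>R One + e) - (q i - d i *\<^sub>R One)) \<bullet> b = 2 * d i + (if b = e then 1 else 0)"
        if "b \<in> Basis" for b
        using that e by (simp add: algebra_simps inner_Basis)
      have "emeasure lborel (box i) = ennreal (\<Prod>b\<in>Basis. 2 * d i + (if b = e then 1 else 0))"
      proof -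
        have "(q i - d i *\<^sub>R One) \<bullet> b \<le> (q i + d i *\<^sub>R One + e) \<bullet> b" if "b \<in> Basis" for b
        proof -
          have "0 \<le> ((q i + d i *\<^sub>R One + e) - (q i - d i *\<^sub>R One)) \<bullet> b"
            unfolding side[OF that] using d by simp
          then show ?thesis unfolding inner_diff_left by linarith
        qed
        then have "emeasure lborel (box i) = ennreal (\<Prod>b\<in>Basis. ((q i + d i *\<^sub>R One + e) - (q i - d i *\<^sub>R One)) \<bullet> b)"
          using False by (simp add: box_def emeasure_lborel_cbox)
        also have "\<dots> = ennreal (\<Prod>b\<in>Basis. 2 * d i + (if b = e then 1 else 0))"
          by (intro arg_cong[where f=ennreal] prod.cong refl side)
        finally show ?thesis .
      qed
      also have "(\<Prod>b\<in>Basis. 2 * d i + (if b = e then 1 else 0)) = (2 * d i + 1) * (2 * d i) ^ ?d"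
        using e by (subst prod.remove[of _ e]) auto
      also have "\<dots> \<le> 3 * (2 * d i) ^ ?d"
        using d by (intro mult_right_mono) auto
      also have "\<dots> = K * (\<omega> * (d i / 2) ^ ?d)"
      proof -
        have "(2 * d i) ^ ?d = (4 * (d i / 2)) ^ ?d" by simp
        then show ?thesis
          using \<open>0 < \<omega>\<close> by (simp only: power_mult_distrib[of 4 "d i / 2"] K_def) simp
      qed
      finally show ?thesis
        using False \<open>0 < K\<close> by (simp add: hausdorff_gauge_def \<omega>_def d_def ennreal_leI ennreal_mult'[symmetric])
    qed (simp add: box_def)
    have "W \<subseteq> (\<Union>i. box i)"
    proof
      fix x assume "x \<in> W"
      then obtain i where i: "x - s x *\<^sub>R e \<in> C i" using proj C(1) by blast
      then have "q i \<in> C i" unfolding q_def by (rule someI)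
      have "dist (x - s x *\<^sub>R e) (q i) \<le> d i"
        unfolding d_def by (intro diameter_bounded_bound C i \<open>q i \<in> C i\<close>)
      have "\<bar>(x - s x *\<^sub>R e - q i) \<bullet> b\<bar> \<le> d i" if "b \<in> Basis" for b
        using Basis_le_norm[OF that, of "x - s x *\<^sub>R e - q i"] \<open>dist _ _ \<le> d i\<close> by (simp add: dist_norm)
      then have near: "\<bar>x \<bullet> b - (if b = e then s x else 0) - q i \<bullet> b\<bar> \<le> d i" if "b \<in> Basis" for b
        using that e by (force simp: inner_diff_left inner_Basis)
      have "0 < s x" "s x < 1" using \<open>x \<in> W\<close> by (auto simp: W_def)
      have "x \<in> cbox (q i - d i *\<^sub>R One) (q i + d i *\<^sub>R One + e)"
        unfolding mem_box
      proof (intro ballI)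
        fix b :: 'a assume b: "b \<in> Basis"
        have "One \<bullet> b = 1" "e \<bullet> b = (if b = e then 1 else 0)"
          using b e by (auto simp: inner_Basis)
        moreover have "\<bar>x \<bullet> b - (if b = e then s x else 0) - q i \<bullet> b\<bar> \<le> d i"
          by (rule near[OF b])
        ultimately show "(q i - d i *\<^sub>R One) \<bullet> b \<le> x \<bullet> b \<and> x \<bullet> b \<le> (q i + d i *\<^sub>R One + e) \<bullet> b"
          using \<open>0 < s x\<close> \<open>s x < 1\<close> unfolding inner_diff_left inner_add_left inner_scaleR_left
          by (auto split: if_splits)
      qed
      then show "x \<in> (\<Union>i. box i)" using i by (auto simp: box_def)
    qed
    then have "emeasure lborel W \<le> emeasure lborel (\<Union>i. box i)"
      by (intro emeasure_mono) (auto simp: box_def)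
    also have "\<dots> \<le> (\<Sum>i. emeasure lborel (box i))"
      by (intro emeasure_subadditive_countably) (auto simp: box_def)
    also have "\<dots> \<le> (\<Sum>i. ennreal K * hausdorff_gauge ?d (C i))"
      by (intro suminf_le vol) auto
    also have "\<dots> = ennreal K * (\<Sum>i. hausdorff_gauge ?d (C i))" by simp
    also have "\<dots> \<le> ennreal K * ennreal (\<epsilon> / K)"
      using C(4) by (intro mult_left_mono) auto
    also have "\<dots> = ennreal \<epsilon>"
      using \<open>0 < K\<close> \<open>0 < \<epsilon>\<close> by (simp flip: ennreal_mult')
    finally show ?thesis by simp
  qed
  then have "emeasure lborel W = 0"
    using ennreal_le_epsilon[of 0 "emeasure lborel W"] by simp
  then have "negligible W"
    using \<open>open W\<close> by (simp add: negligible_iff_null_sets null_sets_completionI null_setsI)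
  then show False
    using \<open>open W\<close> \<open>p + _ \<in> W\<close> open_not_negligible by blast
qed

section \<open>Surface area measures of polytopes\<close>

text \<open>
The normals \<open>U\<close> and the offsets \<open>b\<close> are separate arguments because the proof keeps the normals
and varies the offsets.
\<close>

definition hpoly :: "'a::euclidean_space set \<Rightarrow> ('a \<Rightarrow> real) \<Rightarrow> 'a set" where
  "hpoly U b = {x. \<forall>u\<in>U. x \<bullet> u \<le> b u}"

lemma hpoly_eq_INT: "hpoly U b = (\<Inter>u\<in>U. {x. u \<bullet> x \<le> b u})"
  by (auto simp: hpoly_def inner_commute)

lemma closed_hpoly: "closed (hpoly U b)"
  unfolding hpoly_eq_INT by (intro closed_INT ballI closed_halfspace_le)

lemma convex_hpoly: "convex (hpoly U b)"
  unfolding hpoly_eq_INT by (intro convex_INT convex_halfspace_le)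

lemma hpoly_feasible_direction:
  assumes "finite U" "x \<in> hpoly U b" and z: "\<And>u. u \<in> U \<Longrightarrow> x \<bullet> u = b u \<Longrightarrow> z \<bullet> u \<le> 0"
  shows "eventually (\<lambda>t. x + t *\<^sub>R z \<in> hpoly U b) (at_right 0)"
proof -
  have "eventually (\<lambda>t. (x + t *\<^sub>R z) \<bullet> u \<le> b u) (at_right 0)" if "u \<in> U" for u
  proof (cases "x \<bullet> u = b u")
    case True
    then show ?thesis
      using z[OF that True] unfolding inner_add_left
      by (intro eventually_at_right_less[THEN eventually_mono]) (auto simp: mult_nonneg_nonpos)
  next
    case False
    then have "x \<bullet> u < b u" using assms(2) that by (force simp: hpoly_def)
    moreover have "((\<lambda>t. (x + t *\<^sub>R z) \<bullet> u) \<longlongrightarrow> (x + 0 *\<^sub>R z) \<bullet> u) (at_right 0)"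
      by (intro tendsto_intros)
    ultimately have "eventually (\<lambda>t. (x + t *\<^sub>R z) \<bullet> u < b u) (at_right 0)"
      by (intro order_tendstoD) auto
    then show ?thesis by (rule eventually_mono) auto
  qed
  then have "eventually (\<lambda>t. \<forall>u\<in>U. (x + t *\<^sub>R z) \<bullet> u \<le> b u) (at_right 0)"
    using \<open>finite U\<close> by (intro eventually_ball_finite) auto
  then show ?thesis by (simp add: hpoly_def)
qed

text \<open>
If at most one constraint \<open>u\<close> were tight at \<open>x\<close>, then moving from \<open>x\<close> in direction \<open>w - u\<close> (or \<open>w\<close>, if no
constraint is tight) would stay inside the polyhedron and increase the inner product with \<open>w\<close>.
\<close>

lemma hpoly_new_normal_two_tight:
  assumes "finite U" and unit: "\<And>u. u \<in> U \<Longrightarrow> norm u = 1" and x: "x \<in> hpoly U b"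
    and "norm w = 1" "w \<notin> U" and max: "\<And>y. y \<in> hpoly U b \<Longrightarrow> y \<bullet> w \<le> x \<bullet> w"
  shows "\<exists>u\<in>U. \<exists>u'\<in>U. u \<noteq> u' \<and> x \<bullet> u = b u \<and> x \<bullet> u' = b u'"
proof (rule ccontr)
  assume neg: "\<not> ?thesis"
  have "\<exists>z. 0 < z \<bullet> w \<and> (\<forall>u\<in>U. x \<bullet> u = b u \<longrightarrow> z \<bullet> u \<le> 0)"
  proof (cases "\<exists>u\<in>U. x \<bullet> u = b u")
    case True
    then obtain u where u: "u \<in> U" "x \<bullet> u = b u" by blast
    have uniq: "v = u" if "v \<in> U" "x \<bullet> v = b v" for v using neg u that by blast
    have uu: "u \<bullet> u = 1" "w \<bullet> w = 1"
      using unit[OF u(1)] \<open>norm w = 1\<close> by (auto simp: norm_eq_1)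
    have "w \<bullet> u \<noteq> 1"
    proof
      assume "w \<bullet> u = 1"
      then have "(w - u) \<bullet> (w - u) = 0"
        using uu by (simp add: inner_diff_left inner_diff_right inner_commute)
      then show False using \<open>w \<notin> U\<close> u by simp
    qed
    moreover have "w \<bullet> u \<le> 1"
      using norm_cauchy_schwarz[of w u] unit[OF u(1)] \<open>norm w = 1\<close> by simp
    ultimately have "w \<bullet> u < 1" by simp
    then have "0 < (w - u) \<bullet> w" "(w - u) \<bullet> u \<le> 0"
      using uu by (auto simp: inner_diff_left inner_diff_right inner_commute)
    then show ?thesis using uniq by blast
  next
    case False
    then show ?thesis using \<open>norm w = 1\<close> by (intro exI[of _ w]) (auto simp: norm_eq_1)
  qed
  then obtain z where z: "0 < z \<bullet> w" "\<And>u. u \<in> U \<Longrightarrow> x \<bullet> u = b u \<Longrightarrow> z \<bullet> u \<le> 0" by blast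
  have "eventually (\<lambda>t. x + t *\<^sub>R z \<in> hpoly U b \<and> 0 < t) (at_right 0)"
    using hpoly_feasible_direction[OF \<open>finite U\<close> x z(2)] eventually_at_right_less
    by (rule eventually_conj)
  then obtain t where "x + t *\<^sub>R z \<in> hpoly U b" "0 < (t::real)"
    using eventually_happens'[OF trivial_limit_at_right_real] by blast
  then have "t * (z \<bullet> w) \<le> 0" using max[of "x + t *\<^sub>R z"] by (simp add: inner_add_left)
  then show False using \<open>0 < t\<close> z(1) by (simp add: mult_le_0_iff)
qed

lemma support_function_attained:
  assumes "compact K" "K \<noteq> {}"
  obtains x where "x \<in> K" "x \<bullet> u = support_function K u"
    and "\<And>y. y \<in> K \<Longrightarrow> y \<bullet> u \<le> support_function K u"
proof -
  have "continuous_on K (\<lambda>x. x \<bullet> u)" by (intro continuous_intros)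
  then obtain x where x: "x \<in> K" "\<And>y. y \<in> K \<Longrightarrow> y \<bullet> u \<le> x \<bullet> u"
    using continuous_attains_sup[OF assms] by blast
  then have "support_function K u = x \<bullet> u"
    unfolding support_function_def by (intro cSup_eq_maximum) auto
  with x that show ?thesis by metis
qed

lemma support_function_eqI:
  "x \<in> K \<Longrightarrow> x \<bullet> u = s \<Longrightarrow> (\<And>y. y \<in> K \<Longrightarrow> y \<bullet> u \<le> s) \<Longrightarrow> support_function K u = s"
  unfolding support_function_def by (intro cSup_eq_maximum) auto

lemma support_function_ge:
  "compact K \<Longrightarrow> x \<in> K \<Longrightarrow> x \<bullet> u \<le> support_function K u"
  by (metis empty_iff support_function_attained)

definition exposed_face :: "'a::euclidean_space set \<Rightarrow> 'a \<Rightarrow> 'a set" where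
  "exposed_face K u = {x \<in> K. x \<bullet> u = support_function K u}"

text \<open>
The set whose Hausdorff measure defines \<open>S\<^bsub>K\<^esub>(\<Omega>)\<close>, also known as the reverse spherical image of \<open>\<Omega>\<close>.
\<close>

definition contact_set :: "'a::euclidean_space set \<Rightarrow> 'a set \<Rightarrow> 'a set" where
  "contact_set K \<Omega> = {x \<in> frontier K. \<exists>u\<in>\<Omega>. x \<bullet> u = support_function K u}"

definition ridges :: "'a::euclidean_space set \<Rightarrow> ('a \<Rightarrow> real) \<Rightarrow> 'a set" where
  "ridges U b = {x \<in> hpoly U b. \<exists>u\<in>U. \<exists>u'\<in>U. u \<noteq> u' \<and> x \<bullet> u = b u \<and> x \<bullet> u' = b u'}"

text \<open>
Two distinct unit normals are either linearly independent, and then their constraints are jointly tight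
only in codimension two, or opposite, and then the interior point \<open>x0\<close> rules out joint tightness.
\<close>

lemma hausdorff_measure_ridges:
  fixes U :: "'a::euclidean_space set"
  assumes "finite U" and unit: "\<And>u. u \<in> U \<Longrightarrow> norm u = 1" and "compact (hpoly U b)"
    and x0: "\<And>u. u \<in> U \<Longrightarrow> x0 \<bullet> u < b u"
  shows "hausdorff_measure (DIM('a) - 1) (ridges U b) = 0"
proof -
  let ?H = "hausdorff_measure (DIM('a) - 1) :: 'a set \<Rightarrow> _"
  define R where "R p = hpoly U b \<inter> {x. fst p \<bullet> x = b (fst p)} \<inter> {x. snd p \<bullet> x = b (snd p)}" for p
  define I where "I = {p \<in> U \<times> U. fst p \<noteq> snd p}"
  have "?H (R p) = 0" if "p \<in> I" for p
  proof -
    from that obtain u u' where p: "p = (u, u')" "u \<in> U" "u' \<in> U" "u \<noteq> u'" by (cases p) (auto simp: I_def)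
    show ?thesis
    proof (cases "u' = - u")
      case True
      have "R p = {}"
        using x0[OF p(2)] x0[OF p(3)] True by (auto simp: R_def p inner_commute)
      then show ?thesis by simp
    next
      case False
      \<comment> \<open>The component of \<open>u'\<close> orthogonal to \<open>u\<close>: a direction inside one hyperplane and transversal to the other.\<close>
      define z where "z = u' - (u' \<bullet> u) *\<^sub>R u"
      have uu: "u \<bullet> u = 1" "u' \<bullet> u' = 1" using unit p by (auto simp: norm_eq_1)
      have "z \<bullet> u = 0" using uu by (simp add: z_def inner_diff_left)
      moreover have "z \<bullet> u' \<noteq> 0"
      proof
        assume "z \<bullet> u' = 0"
        then have "(u' \<bullet> u)\<^sup>2 = 1"
          using uu by (simp add: z_def inner_diff_left power2_eq_square inner_commute[of u u'])
        then have "u' \<bullet> u = 1 \<or> u' \<bullet> u = -1" by (simp add: power2_eq_1_iff)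
        then have "(u' - u) \<bullet> (u' - u) = 0 \<or> (u' + u) \<bullet> (u' + u) = 0"
          using uu by (auto simp: inner_diff_left inner_diff_right inner_add_left inner_add_right inner_commute)
        then have "u' - u = 0 \<or> u' + u = 0" by (simp only: inner_eq_zero_iff)
        then show False using p False by (metis eq_neg_iff_add_eq_0 eq_iff_diff_eq_0)
      qed
      moreover have "compact (R p)"
        unfolding R_def by (intro compact_Int_closed closed_hyperplane assms)
      moreover have "u \<noteq> 0" using uu by auto
      ultimately show ?thesis
        by (intro hausdorff_measure_codim2_null[where u=u and w=u' and z=z]) 
           (auto simp: R_def p inner_commute)
    qed
  qed
  moreover have "finite I" using \<open>finite U\<close> by (auto simp: I_def)
  ultimately have "?H (\<Union>p\<in>I. R p) \<le> 0"
    using hausdorff_measure_UN_le[of I "DIM('a) - 1" R] by simp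
  moreover have "ridges U b \<subseteq> (\<Union>p\<in>I. R p)"
    by (auto simp: ridges_def R_def I_def inner_commute)
  ultimately show ?thesis
    using hausdorff_measure_mono[of "ridges U b" "\<Union>p\<in>I. R p"] by (metis le_zero_eq order_trans)
qed

lemma contact_set_subset:
  assumes "finite U" and unit: "\<And>u. u \<in> U \<Longrightarrow> norm u = 1" and K: "compact K" "K = hpoly U b"
    and "\<Omega> \<subseteq> sphere 0 1"
  shows "contact_set K \<Omega> \<subseteq> (\<Union>u\<in>\<Omega> \<inter> U. exposed_face K u) \<union> ridges U b"
proof
  fix x assume "x \<in> contact_set K \<Omega>"
  then obtain w where w: "x \<in> K" "w \<in> \<Omega>" "x \<bullet> w = support_function K w"
    using K closed_hpoly[of U b] by (auto simp: contact_set_def frontier_def)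
  show "x \<in> (\<Union>u\<in>\<Omega> \<inter> U. exposed_face K u) \<union> ridges U b"
  proof (cases "w \<in> U")
    case True
    then show ?thesis using w by (auto simp: exposed_face_def)
  next
    case False
    have "norm w = 1" using w \<open>\<Omega> \<subseteq> _\<close> by auto
    then have "\<exists>u\<in>U. \<exists>u'\<in>U. u \<noteq> u' \<and> x \<bullet> u = b u \<and> x \<bullet> u' = b u'"
      using assms w False support_function_ge[OF K(1)]
      by (intro hpoly_new_normal_two_tight[where w=w]) auto
    then show ?thesis using w K by (auto simp: ridges_def)
  qed
qed

lemma exposed_face_subset_contact_set:
  assumes "compact K" "u \<in> \<Omega>" "u \<noteq> 0"
  shows "exposed_face K u \<subseteq> contact_set K \<Omega>"
proof
  fix x assume x: "x \<in> exposed_face K u"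
  have "x \<notin> interior K"
  proof
    assume "x \<in> interior K"
    then obtain r where "0 < r" "cball x r \<subseteq> K" by (meson mem_interior_cball)
    moreover have "x + (r / norm u) *\<^sub>R u \<in> cball x r"
      using \<open>0 < r\<close> \<open>u \<noteq> 0\<close> by (simp add: dist_norm)
    ultimately have "(x + (r / norm u) *\<^sub>R u) \<bullet> u \<le> x \<bullet> u"
      using support_function_ge[OF \<open>compact K\<close>] x by (force simp: exposed_face_def)
    then have "r / norm u * (u \<bullet> u) \<le> 0" by (simp add: inner_add_left)
    moreover have "0 < r / norm u * (u \<bullet> u)" using \<open>0 < r\<close> \<open>u \<noteq> 0\<close> by simp
    ultimately show False by linarith
  qed
  moreover have "x \<in> closure K" using x closure_subset by (auto simp: exposed_face_def)
  ultimately show "x \<in> contact_set K \<Omega>"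
    using x \<open>u \<in> \<Omega>\<close> by (auto simp: contact_set_def frontier_def exposed_face_def)
qed

lemma surface_area_measure_eq:
  "surface_area_measure K = measure_of (sphere 0 1) (sets (restrict_space borel (sphere 0 1)))
     (\<lambda>\<Omega>. hausdorff_measure (DIM('a) - 1) (contact_set (K :: 'a::euclidean_space set) \<Omega>))"
  by (simp add: surface_area_measure_def contact_set_def)

lemma sets_surface_area_measure:
  "sets (surface_area_measure K) = sets (restrict_space borel (sphere 0 1))"
  using sets.sets_measure_of_eq[of "restrict_space borel (sphere 0 1)"]
  by (simp add: surface_area_measure_def space_restrict_space)

lemma surface_area_measure_subset_sphere:
  "\<Omega> \<in> sets (surface_area_measure K) \<Longrightarrow> \<Omega> \<subseteq> sphere 0 1"
  unfolding sets_surface_area_measure by (auto simp: sets_restrict_space)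

text \<open>
A boundary point with a normal outside \<open>U\<close> lies in two facets. If the set function that defines the
surface area measure fails to be countably additive, \<open>measure_of\<close> returns the zero measure, and the
claim is trivial.
\<close>

lemma surface_area_measure_null_off_normals:
  fixes U :: "'a::euclidean_space set"
  assumes "finite U" and unit: "\<And>u. u \<in> U \<Longrightarrow> norm u = 1" and "compact (hpoly U b)"
    and x0: "\<And>u. u \<in> U \<Longrightarrow> x0 \<bullet> u < b u"
    and \<Omega>: "\<Omega> \<in> sets (surface_area_measure (hpoly U b))" "\<Omega> \<inter> U = {}"
  shows "emeasure (surface_area_measure (hpoly U b)) \<Omega> = 0"
proof -
  have "contact_set (hpoly U b) \<Omega> \<subseteq> ridges U b"
    using contact_set_subset[OF assms(1-3) refl surface_area_measure_subset_sphere[OF \<Omega>(1)]] \<Omega>(2) by simp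
  then have "hausdorff_measure (DIM('a) - 1) (contact_set (hpoly U b) \<Omega>) = 0"
    using hausdorff_measure_ridges[OF assms(1-4)] hausdorff_measure_mono by (metis le_zero_eq)
  then show ?thesis
    by (simp add: surface_area_measure_eq emeasure_measure_of_conv)
qed

text \<open>
\<open>U\<close> is the set of outer unit facet normals of \<open>P\<close>. That each \<open>u \<in> U\<close> really belongs to a facet is expressed
by irredundancy: dropping any single constraint enlarges the polytope.
\<close>

locale facet_presentation =
  fixes P U :: "'a::euclidean_space set" and x0 :: 'a
  assumes finite_normals: "finite U"
    and unit_normals: "\<And>u. u \<in> U \<Longrightarrow> norm u = 1"
    and compact_P: "compact P"
    and P_eq: "P = hpoly U (support_function P)"
    and strict: "\<And>u. u \<in> U \<Longrightarrow> x0 \<bullet> u < support_function P u"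
    and irredundant: "\<And>j. j \<in> U \<Longrightarrow> \<exists>y. (\<forall>u\<in>U - {j}. y \<bullet> u \<le> support_function P u) \<and> support_function P j < y \<bullet> j"
begin

abbreviation "h \<equiv> support_function P"

lemma mem_P_iff: "x \<in> P \<longleftrightarrow> (\<forall>u\<in>U. x \<bullet> u \<le> h u)"
  using P_eq by (auto simp: hpoly_def)

lemma x0_in_P: "x0 \<in> P"
  using strict by (force simp: mem_P_iff intro: less_imp_le)

text \<open>
The segment from the interior point \<open>x0\<close> to a point violating only the constraint \<open>j\<close> leaves \<open>P\<close> through the
relative interior of the facet.
\<close>

lemma facet_point:
  assumes "j \<in> U"
  obtains p where "p \<bullet> j = h j" "\<And>u. u \<in> U - {j} \<Longrightarrow> p \<bullet> u < h u"
proof -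
  obtain y where y: "\<And>u. u \<in> U - {j} \<Longrightarrow> y \<bullet> u \<le> h u" "h j < y \<bullet> j"
    using irredundant[OF assms] by blast
  define t where "t = (h j - x0 \<bullet> j) / (y \<bullet> j - x0 \<bullet> j)"
  have t: "0 < t" "t < 1" using y(2) strict[OF assms] by (auto simp: t_def field_simps)
  define p where "p = (1 - t) *\<^sub>R x0 + t *\<^sub>R y"
  have "p \<bullet> j = x0 \<bullet> j + t * (y \<bullet> j - x0 \<bullet> j)" by (simp add: p_def inner_add_left algebra_simps)
  then have "p \<bullet> j = h j" using y(2) strict[OF assms] by (simp add: t_def)
  moreover have "p \<bullet> u < h u" if "u \<in> U - {j}" for u
  proof -
    have "(1 - t) * (x0 \<bullet> u) + t * (y \<bullet> u) < (1 - t) * h u + t * h u"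
      using t strict[of u] y(1)[OF that] that by (intro add_less_le_mono mult_strict_left_mono mult_left_mono) auto
    then show ?thesis by (simp add: p_def inner_add_left algebra_simps)
  qed
  ultimately show ?thesis using that by blast
qed

lemma hausdorff_measure_facet_pos:
  assumes "j \<in> U"
  shows "0 < hausdorff_measure (DIM('a) - 1) (exposed_face P j)"
proof -
  obtain p where p: "p \<bullet> j = h j" "\<And>u. u \<in> U - {j} \<Longrightarrow> p \<bullet> u < h u"
    using facet_point[OF assms] by blast
  define V where "V = (\<Inter>u\<in>U - {j}. {x. u \<bullet> x < h u})"
  have "open V" unfolding V_def using finite_normals by (intro open_INT ballI open_halfspace_lt) auto
  moreover have "p \<in> V" using p by (auto simp: V_def inner_commute)
  moreover have "j \<noteq> 0" using unit_normals[OF assms] by auto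
  ultimately have "0 < hausdorff_measure (DIM('a) - 1) (V \<inter> {x. x \<bullet> j = h j})"
    using p(1) by (intro hausdorff_measure_relopen_hyperplane_pos)
  also have "\<dots> \<le> hausdorff_measure (DIM('a) - 1) (exposed_face P j)"
  proof (intro hausdorff_measure_mono subsetI)
    fix x assume x: "x \<in> V \<inter> {x. x \<bullet> j = h j}"
    then have "x \<bullet> u \<le> h u" if "u \<in> U" for u
      using that by (cases "u = j") (auto simp: V_def inner_commute intro: less_imp_le)
    then show "x \<in> exposed_face P j" using x by (simp add: exposed_face_def mem_P_iff)
  qed
  finally show ?thesis .
qed

text \<open>
Facets may intersect, so they are contracted by the factor \<open>1 / L\<close> towards relative interior points
\<open>p u\<close>. The contracted facets are disjoint, and contraction changes the measure by the factor
\<open>L ^ (n - 1)\<close>, which tends to 1.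
\<close>

lemma hausdorff_measure_facets_additive:
  assumes "I \<subseteq> U"
  shows "(\<Sum>u\<in>I. hausdorff_measure (DIM('a) - 1) (exposed_face P u)) \<le> hausdorff_measure (DIM('a) - 1) (\<Union>u\<in>I. exposed_face P u)"
    (is "?A \<le> ?B")
proof -
  let ?H = "hausdorff_measure (DIM('a) - 1)"
  have "finite I" using assms finite_normals finite_subset by blast
  have "\<exists>p. \<forall>j\<in>U. p j \<bullet> j = h j \<and> (\<forall>u\<in>U - {j}. p j \<bullet> u < h u)"
    by (intro bchoice ballI) (metis facet_point)
  then obtain p where p: "\<And>j. j \<in> U \<Longrightarrow> p j \<bullet> j = h j" "\<And>j u. j \<in> U \<Longrightarrow> u \<in> U \<Longrightarrow> u \<noteq> j \<Longrightarrow> p j \<bullet> u < h u"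
    by blast
  have le: "?A \<le> ?B * ennreal (L ^ (DIM('a) - 1))" if "1 < L" for L :: real
  proof -
    define f where "f u x = p u + (1 / L) *\<^sub>R (x - p u)" for u x
    define S where "S u = f u ` exposed_face P u" for u
    have "0 < L" using that by simp
    have fi: "f u x \<bullet> v = (1 - 1 / L) * (p u \<bullet> v) + (1 / L) * (x \<bullet> v)" for u x v
      by (simp add: f_def inner_add_left inner_diff_left algebra_simps)
    have in_face: "f u x \<in> exposed_face P u \<and> (\<forall>v\<in>U - {u}. f u x \<bullet> v < h v)" if "u \<in> I" "x \<in> exposed_face P u" for u x
    proof -
      have u: "u \<in> U" using that assms by blast
      have x: "x \<bullet> u = h u" "\<And>v. v \<in> U \<Longrightarrow> x \<bullet> v \<le> h v" using that by (auto simp: exposed_face_def mem_P_iff)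
      have "f u x \<bullet> u = h u" using p(1)[OF u] x(1) unfolding fi by (simp add: algebra_simps)
      moreover have lt: "f u x \<bullet> v < h v" if "v \<in> U - {u}" for v
      proof -
        have "f u x \<bullet> v < (1 - 1 / L) * h v + (1 / L) * h v"
          unfolding fi using \<open>1 < L\<close> p(2)[OF u, of v] x(2)[of v] that
          by (intro add_less_le_mono mult_strict_left_mono mult_left_mono) auto
        then show ?thesis by (simp add: algebra_simps)
      qed
      ultimately show ?thesis by (force simp: exposed_face_def mem_P_iff intro: less_imp_le)
    qed
    have "compact (exposed_face P u)" for u
    proof -
      have "exposed_face P u = P \<inter> {x. u \<bullet> x = h u}" by (auto simp: exposed_face_def inner_commute)
      then show ?thesis using compact_Int_closed[OF compact_P closed_hyperplane] by simp
    qed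
    then have cS: "compact (S u)" for u
      unfolding S_def f_def by (intro compact_continuous_image continuous_intros)
    have "?A \<le> (\<Sum>u\<in>I. ennreal (L ^ (DIM('a) - 1)) * ?H (S u))"
    proof (rule sum_mono)
      fix u assume "u \<in> I"
      define g where "g x = p u + L *\<^sub>R (x - p u)" for x
      have "g (f u x) = x" for x using \<open>0 < L\<close> by (simp add: g_def f_def)
      then have "exposed_face P u = g ` S u" by (simp add: S_def image_image)
      moreover have "dist (g x) (g y) \<le> L * dist x y" for x y
      proof -
        have "g x - g y = L *\<^sub>R (x - y)" by (simp add: g_def algebra_simps)
        then show ?thesis using \<open>0 < L\<close> by (simp add: dist_norm)
      qed
      ultimately show "?H (exposed_face P u) \<le> ennreal (L ^ (DIM('a) - 1)) * ?H (S u)"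
        using hausdorff_measure_lipschitz_image[of "S u" g L "DIM('a) - 1"] \<open>0 < L\<close> by simp
    qed
    also have "\<dots> = ennreal (L ^ (DIM('a) - 1)) * (\<Sum>u\<in>I. ?H (S u))"
      by (simp add: sum_distrib_left)
    also have "\<dots> \<le> ennreal (L ^ (DIM('a) - 1)) * ?H (\<Union>u\<in>I. S u)"
    proof (intro mult_left_mono hausdorff_measure_disjoint_compact \<open>finite I\<close> cS)
      show "disjoint_family_on S I"
        unfolding disjoint_family_on_def
      proof (intro ballI impI, rule ccontr)
        fix u v assume uv: "u \<in> I" "v \<in> I" "u \<noteq> v" "S u \<inter> S v \<noteq> {}"
        then obtain x y where xy: "x \<in> exposed_face P u" "y \<in> exposed_face P v" "f u x = f v y"
          unfolding S_def by blast
        have "f u x \<bullet> v < h v" using in_face[OF uv(1) xy(1)] uv assms by blast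
        moreover have "f v y \<bullet> v = h v" using in_face[OF uv(2) xy(2)] by (simp add: exposed_face_def)
        ultimately show False using xy by simp
      qed
    qed simp
    also have "\<dots> \<le> ennreal (L ^ (DIM('a) - 1)) * ?B"
      using in_face by (intro mult_left_mono hausdorff_measure_mono) (auto simp: S_def)
    finally show ?thesis by (simp add: mult.commute)
  qed
  show ?thesis
  proof (cases "?B = top")
    case False
    have "((\<lambda>L. ennreal (L ^ (DIM('a) - 1))) \<longlongrightarrow> ennreal (1 ^ (DIM('a) - 1))) (at_right 1)"
      by (intro tendsto_intros)
    then have "((\<lambda>L. ?B * ennreal (L ^ (DIM('a) - 1))) \<longlongrightarrow> ?B * ennreal (1 ^ (DIM('a) - 1))) (at_right 1)"
      using False by (intro ennreal_tendsto_cmult) (auto simp: less_top)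
    moreover have "eventually (\<lambda>L. ?A \<le> ?B * ennreal (L ^ (DIM('a) - 1))) (at_right 1)"
      using eventually_at_right_less[of 1] by (rule eventually_mono) (rule le)
    ultimately have "?A \<le> ?B * ennreal (1 ^ (DIM('a) - 1))"
      by (intro tendsto_lowerbound) auto
    then show ?thesis by simp
  qed simp
qed

lemma hausdorff_measure_contact_set:
  assumes "\<Omega> \<subseteq> sphere 0 1"
  shows "hausdorff_measure (DIM('a) - 1) (contact_set P \<Omega>) =
    (\<Sum>u\<in>U. hausdorff_measure (DIM('a) - 1) (exposed_face P u) * indicator \<Omega> u)"
proof -
  let ?H = "hausdorff_measure (DIM('a) - 1)"
  have "?H (contact_set P \<Omega>) \<le> ?H ((\<Union>u\<in>\<Omega> \<inter> U. exposed_face P u) \<union> ridges U h)"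
    by (intro hausdorff_measure_mono contact_set_subset finite_normals unit_normals compact_P P_eq assms)
  also have "\<dots> \<le> ?H (\<Union>u\<in>\<Omega> \<inter> U. exposed_face P u) + ?H (ridges U h)"
    by (rule hausdorff_measure_Un_le)
  also have "?H (ridges U h) = 0"
    using hausdorff_measure_ridges[OF finite_normals unit_normals _ strict] compact_P P_eq by metis
  also have "?H (\<Union>u\<in>\<Omega> \<inter> U. exposed_face P u) + 0 \<le> (\<Sum>u\<in>\<Omega> \<inter> U. ?H (exposed_face P u))"
    using finite_normals hausdorff_measure_UN_le[of "\<Omega> \<inter> U"] by simp
  finally have "?H (contact_set P \<Omega>) \<le> (\<Sum>u\<in>\<Omega> \<inter> U. ?H (exposed_face P u))" .
  moreover have "(\<Sum>u\<in>\<Omega> \<inter> U. ?H (exposed_face P u)) \<le> ?H (\<Union>u\<in>\<Omega> \<inter> U. exposed_face P u)"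
    by (rule hausdorff_measure_facets_additive) simp
  moreover have "?H (\<Union>u\<in>\<Omega> \<inter> U. exposed_face P u) \<le> ?H (contact_set P \<Omega>)"
  proof (intro hausdorff_measure_mono UN_least)
    fix u assume "u \<in> \<Omega> \<inter> U"
    then show "exposed_face P u \<subseteq> contact_set P \<Omega>"
      using unit_normals[of u] by (intro exposed_face_subset_contact_set compact_P) auto
  qed
  ultimately have "?H (contact_set P \<Omega>) = (\<Sum>u\<in>\<Omega> \<inter> U. ?H (exposed_face P u))"
    by (intro order_antisym) (auto intro: order_trans)
  also have "\<dots> = (\<Sum>u\<in>U. ?H (exposed_face P u) * indicator \<Omega> u)"
    using finite_normals by (intro sum.mono_neutral_cong_left) (auto simp: indicator_def)
  finally show ?thesis .
qed

text \<open>
The formula \<open>hausdorff_measure_contact_set\<close> describes a sum of point masses, hence a countably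
additive set function; this is what makes \<open>measure_of\<close> return the intended values.
\<close>

lemma emeasure_surface_area_measure:
  assumes "\<Omega> \<in> sets (surface_area_measure P)"
  shows "emeasure (surface_area_measure P) \<Omega> = 
    (\<Sum>u\<in>U. hausdorff_measure (DIM('a) - 1) (exposed_face P u) * indicator \<Omega> u)"
proof -
  let ?H = "hausdorff_measure (DIM('a) - 1)"
  let ?M = "surface_area_measure P"
  have "emeasure ?M \<Omega> = ?H (contact_set P \<Omega>)"
  proof (rule emeasure_measure_of[OF surface_area_measure_eq _ _ _ assms])
    show "sets (restrict_space borel (sphere 0 1)) \<subseteq> Pow (sphere (0::'a) 1)"
      by (auto simp: sets_restrict_space)
    show "positive (sets ?M) (\<lambda>\<Omega>. ?H (contact_set P \<Omega>))"
      by (simp add: positive_def contact_set_def)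
    show "countably_additive (sets ?M) (\<lambda>\<Omega>. ?H (contact_set P \<Omega>))"
    proof (rule countably_additiveI)
      fix A :: "nat \<Rightarrow> 'a set"
      assume A: "range A \<subseteq> sets ?M" "disjoint_family A" "(\<Union>i. A i) \<in> sets ?M"
      have "(\<Sum>i. ?H (contact_set P (A i))) = (\<Sum>i. \<Sum>u\<in>U. ?H (exposed_face P u) * indicator (A i) u)"
      proof (intro suminf_cong hausdorff_measure_contact_set)
        show "A i \<subseteq> sphere 0 1" for i
          using A(1) surface_area_measure_subset_sphere[of "A i" P] by blast
      qed
      also have "\<dots> = (\<Sum>u\<in>U. \<Sum>i. ?H (exposed_face P u) * indicator (A i) u)"
        by (rule suminf_sum) simp
      also have "\<dots> = (\<Sum>u\<in>U. ?H (exposed_face P u) * indicator (\<Union>i. A i) u)"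
        by (simp add: suminf_indicator[OF A(2)])
      also have "\<dots> = ?H (contact_set P (\<Union>i. A i))"
        by (rule hausdorff_measure_contact_set[OF surface_area_measure_subset_sphere[OF A(3)], symmetric])
      finally show "(\<Sum>i. ?H (contact_set P (A i))) = ?H (contact_set P (\<Union>i. A i))" .
    qed
  qed
  then show ?thesis
    using hausdorff_measure_contact_set[OF surface_area_measure_subset_sphere[OF assms]] by simp
qed

lemma surface_area_measure_null_imp:
  assumes "\<Omega> \<in> null_sets (surface_area_measure P)"
  shows "\<Omega> \<inter> U = {}"
proof (rule ccontr)
  assume "\<Omega> \<inter> U \<noteq> {}"
  then obtain u where u: "u \<in> \<Omega>" "u \<in> U" by blast
  have "(\<Sum>u\<in>U. hausdorff_measure (DIM('a) - 1) (exposed_face P u) * indicator \<Omega> u) = 0"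
    using assms emeasure_surface_area_measure by (auto simp: null_sets_def)
  then have "hausdorff_measure (DIM('a) - 1) (exposed_face P u) * indicator \<Omega> u = 0"
    using u finite_normals by (subst (asm) sum_eq_0_iff) auto
  then show False using hausdorff_measure_facet_pos[OF u(2)] u(1) by simp
qed

lemma absolutely_continuous_same_normals:
  assumes "compact (hpoly U b)" "\<And>u. u \<in> U \<Longrightarrow> y \<bullet> u < b u"
  shows "absolutely_continuous (surface_area_measure P) (surface_area_measure (hpoly U b))"
  unfolding absolutely_continuous_def
proof
  fix \<Omega> assume \<Omega>: "\<Omega> \<in> null_sets (surface_area_measure P)"
  then have sets: "\<Omega> \<in> sets (surface_area_measure (hpoly U b))"
    by (auto simp: null_sets_def sets_surface_area_measure)
  with surface_area_measure_null_off_normals[OF finite_normals unit_normals assms sets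
      surface_area_measure_null_imp[OF \<Omega>]]
  show "\<Omega> \<in> null_sets (surface_area_measure (hpoly U b))" by (intro null_setsI)
qed

end

section \<open>Extreme points and facet presentations\<close>

lemma finite_positive_lower_bound:
  fixes f :: "'b \<Rightarrow> real"
  assumes "finite S" "\<And>s. s \<in> S \<Longrightarrow> 0 < f s"
  shows "\<exists>r>0. \<forall>s\<in>S. r \<le> f s"
proof (intro exI conjI ballI)
  show "0 < Min (insert 1 (f ` S))" using assms by (subst Min_gr_iff) auto
  show "Min (insert 1 (f ` S)) \<le> f s" if "s \<in> S" for s using that assms(1) by (intro Min_le) auto
qed

text \<open>
A vector \<open>z\<close> orthogonal to all tight normals can be followed a little in both directions, so \<open>x\<close> would be the
midpoint of a segment in the polyhedron.
\<close>

lemma extreme_point_tight_span: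
  assumes "finite U" and x: "x extreme_point_of hpoly U b"
  shows "span {u \<in> U. x \<bullet> u = b u} = UNIV"
proof (rule ccontr)
  let ?T = "{u \<in> U. x \<bullet> u = b u}"
  assume "span ?T \<noteq> UNIV"
  then have "dim ?T < DIM('a)"
    by (metis dim_eq_full dim_subset_UNIV le_neq_implies_less)
  then obtain z where z: "z \<noteq> 0" "\<And>u. u \<in> span ?T \<Longrightarrow> orthogonal z u"
    using orthogonal_to_subspace_exists by blast
  then have z0: "z \<bullet> u = 0" if "u \<in> U" "x \<bullet> u = b u" for u
    using that span_base[of u ?T] by (auto simp: orthogonal_def)
  have x_in: "x \<in> hpoly U b" using x by (simp add: extreme_point_of_def)
  have "eventually (\<lambda>t. x + t *\<^sub>R z \<in> hpoly U b \<and> x + t *\<^sub>R (- z) \<in> hpoly U b \<and> 0 < t) (at_right 0)"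
    using z0 by (intro eventually_conj hpoly_feasible_direction \<open>finite U\<close> x_in eventually_at_right_less) auto
  then obtain t :: real where t: "x + t *\<^sub>R z \<in> hpoly U b" "x + t *\<^sub>R (- z) \<in> hpoly U b" "0 < t"
    using eventually_happens'[OF trivial_limit_at_right_real] by blast
  have "midpoint (x + t *\<^sub>R z) (x + t *\<^sub>R (- z)) = x"
    by (simp add: midpoint_def algebra_simps flip: scaleR_2)
  moreover have "x + t *\<^sub>R z \<noteq> x + t *\<^sub>R (- z)"
    using \<open>0 < t\<close> \<open>z \<noteq> 0\<close> by (simp add: eq_neg_iff_add_eq_0 flip: scaleR_2)
  ultimately have "x \<in> open_segment (x + t *\<^sub>R z) (x + t *\<^sub>R (- z))"
    using midpoint_in_open_segment by metis
  then show False using x t by (auto simp: extreme_point_of_def)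
qed

lemma inj_on_tight:
  assumes "finite U"
  shows "inj_on (\<lambda>x. {u \<in> U. x \<bullet> u = b u}) {x. x extreme_point_of hpoly U b}"
proof (rule inj_onI)
  fix x y assume "x \<in> {x. x extreme_point_of hpoly U b}"
    and eq: "{u \<in> U. x \<bullet> u = b u} = {u \<in> U. y \<bullet> u = b u}"
  then have span: "span {u \<in> U. x \<bullet> u = b u} = UNIV"
    using extreme_point_tight_span[OF assms] by blast
  have "orthogonal (x - y) u" if "u \<in> {u \<in> U. x \<bullet> u = b u}" for u
    using that that[unfolded eq] by (simp add: orthogonal_def inner_diff_left)
  then have "orthogonal (x - y) (x - y)"
    using orthogonal_to_span[of "x - y" "{u \<in> U. x \<bullet> u = b u}" "x - y"] span by auto
  then show "x = y" by (simp add: orthogonal_def)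
qed

lemma finite_extreme_points_hpoly:
  assumes "finite U"
  shows "finite {x. x extreme_point_of hpoly U b}"
  using inj_on_tight[OF assms] by (rule inj_on_finite[where B = "Pow U"]) (use assms in auto)

text \<open>
Normalise any description of \<open>P\<close> by finitely many halfspaces, replace the offsets by the values of
the support function, and pick a subset of normals of minimal size that still describes \<open>P\<close>.
\<close>

lemma facet_presentation_exists:
  fixes P :: "'a::euclidean_space set"
  assumes "polytope P" "aff_dim P = int DIM('a)"
  shows "\<exists>U x0. facet_presentation P U x0"
proof -
  let ?h = "support_function P"
  have comp: "compact P" using assms polytope_imp_compact by blast
  have ne: "P \<noteq> {}" using assms by auto
  have "interior P \<noteq> {}"
    using assms rel_interior_eq_empty[OF polytope_imp_convex[OF assms(1)]] ne
    by (simp add: interior_rel_interior_gen)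
  then obtain x0 where "x0 \<in> interior P" by blast
  then obtain r where r: "0 < r" "cball x0 r \<subseteq> P" by (meson mem_interior_cball)
  have strict: "x0 \<bullet> u < ?h u" if "norm u = 1" for u
  proof -
    have "x0 + r *\<^sub>R u \<in> P" using r that by (intro subsetD[OF r(2)]) (simp add: dist_norm)
    then have "(x0 + r *\<^sub>R u) \<bullet> u \<le> ?h u" by (rule support_function_ge[OF comp])
    moreover have "u \<bullet> u = 1" using that by (simp add: norm_eq_1)
    ultimately show ?thesis using r(1) by (simp add: inner_add_left)
  qed
  obtain F where F: "finite F" "P = \<Inter>F" "\<forall>H\<in>F. \<exists>a b. a \<noteq> 0 \<and> H = {x. a \<bullet> x \<le> b}"
    using polytope_imp_polyhedron[OF assms(1)] by (auto simp: polyhedron_def)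
  obtain a b where ab: "\<And>H. H \<in> F \<Longrightarrow> a H \<noteq> 0 \<and> H = {x. a H \<bullet> x \<le> b H}"
    using F(3) by metis
  define U0 where "U0 = (\<lambda>H. a H /\<^sub>R norm (a H)) ` F"
  define good where "good U \<longleftrightarrow> finite U \<and> (\<forall>u\<in>U. norm u = 1) \<and> P = hpoly U ?h" for U
  have "hpoly U0 ?h \<subseteq> P"
  proof
    fix x assume x: "x \<in> hpoly U0 ?h"
    have "x \<in> H" if "H \<in> F" for H
    proof -
      let ?u = "a H /\<^sub>R norm (a H)"
      obtain p where p: "p \<in> P" "p \<bullet> ?u = ?h ?u" using support_function_attained[OF comp ne] by metis
      then have "p \<in> H" using F(2) that by blast
      then have "a H \<bullet> p \<le> b H" using ab[OF that] by blast
      moreover have "x \<bullet> ?u \<le> p \<bullet> ?u" using x p that by (auto simp: hpoly_def U0_def)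
      ultimately have "a H \<bullet> x \<le> b H"
        using ab[OF that] by (simp add: inner_commute mult_le_cancel_left_pos divide_le_cancel field_simps)
      then show ?thesis using ab[OF that] by blast
    qed
    then show "x \<in> P" using F(2) by blast
  qed
  moreover have sub: "P \<subseteq> hpoly U ?h" for U
    using support_function_ge[OF comp] by (auto simp: hpoly_def)
  ultimately have "good U0" using F(1) ab by (auto simp: good_def U0_def)
  then obtain U where U: "good U" "\<And>V. good V \<Longrightarrow> card U \<le> card V"
    using ex_has_least_nat[of good U0 card] by blast
  have "\<exists>y. (\<forall>u\<in>U - {j}. y \<bullet> u \<le> ?h u) \<and> ?h j < y \<bullet> j" if "j \<in> U" for j
  proof -
    have "card (U - {j}) < card U" using U(1) that by (intro card_Diff1_less) (auto simp: good_def)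
    then have "P \<noteq> hpoly (U - {j}) ?h" using U(2)[of "U - {j}"] U(1) by (force simp: good_def)
    then obtain y where y: "y \<in> hpoly (U - {j}) ?h" "y \<notin> P" using sub by blast
    have "P = hpoly U ?h" using U(1) by (simp add: good_def)
    then have "\<not> (\<forall>u\<in>U. y \<bullet> u \<le> ?h u)" using y(2) by (auto simp: hpoly_def)
    moreover have le: "\<forall>u\<in>U - {j}. y \<bullet> u \<le> ?h u" using y(1) by (simp add: hpoly_def)
    ultimately have "?h j < y \<bullet> j" by (metis DiffI not_le singletonD)
    then show ?thesis using le by blast
  qed
  then have "facet_presentation P U x0"
    using U(1) strict comp by unfold_locales (auto simp: good_def)
  then show ?thesis by blast
qed

context facet_presentation
begin

text \<open>
At an extreme point at least \<open>n\<close> constraints are tight, since their normals span the space, but not all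
of them are: otherwise \<open>P\<close> would contain the ray from the extreme point through \<open>x0\<close>. So exactly
one constraint is slack, and it determines the extreme point. Therefore there are at most \<open>n + 1\<close>
extreme points, which is only possible for an affinely independent set.
\<close>

lemma simplex_if_few_normals:
  assumes "card U \<le> DIM('a) + 1" "aff_dim P = int DIM('a)"
  shows "int DIM('a) simplex P"
proof -
  define E where "E = {x. x extreme_point_of P}"
  have hull: "P = convex hull E"
    unfolding E_def by (rule Krein_Milman_Minkowski[OF compact_P]) (metis P_eq convex_hpoly)
  define T where "T x = {u \<in> U. x \<bullet> u = h u}" for x
  have E_eq: "E = {x. x extreme_point_of hpoly U h}" unfolding E_def using P_eq by simp
  have inj: "inj_on T E"
    unfolding T_def E_eq by (rule inj_on_tight[OF finite_normals])
  have T: "\<exists>u\<in>U. T x = U - {u}" if "x \<in> E" for x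
  proof -
    have "span (T x) = UNIV"
      using that extreme_point_tight_span[OF finite_normals, of x h] by (simp add: T_def E_eq)
    then have "DIM('a) \<le> card (T x)"
      using dim_le_card'[of "T x"] dim_span[of "T x"] finite_normals by (simp add: T_def)
    have "T x \<noteq> U"
    proof
      assume all: "T x = U"
      have "x \<in> P" using that by (simp add: E_def extreme_point_of_def)
      have ray: "x + t *\<^sub>R (x0 - x) \<in> P" if "0 \<le> t" for t
      proof -
        have "(x + t *\<^sub>R (x0 - x)) \<bullet> u \<le> h u" if "u \<in> U" for u
        proof -
          have "x \<bullet> u = h u" using all that by (auto simp: T_def)
          moreover have "t * (x0 \<bullet> u - h u) \<le> 0"
            using strict[OF that] \<open>0 \<le> t\<close> by (simp add: mult_nonneg_nonpos)
          ultimately show ?thesis by (simp add: inner_add_left inner_diff_left)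
        qed
        then show ?thesis by (simp add: mem_P_iff)
      qed
      obtain B where B: "0 < B" "\<And>y. y \<in> P \<Longrightarrow> norm y \<le> B"
        using compact_imp_bounded[OF compact_P] by (auto simp: bounded_pos)
      have "U \<noteq> {}" using \<open>DIM('a) \<le> card (T x)\<close> all by auto
      then obtain u where "u \<in> U" by blast
      then have "x \<bullet> u = h u" using all by (auto simp: T_def)
      then have "x0 \<noteq> x" using strict[OF \<open>u \<in> U\<close>] by auto
      define t where "t = (2 * B + 1) / norm (x0 - x)"
      have "0 \<le> t" using B by (simp add: t_def)
      have "norm (t *\<^sub>R (x0 - x)) = 2 * B + 1" using \<open>x0 \<noteq> x\<close> B by (simp add: t_def)
      moreover have "norm (t *\<^sub>R (x0 - x)) \<le> norm (x + t *\<^sub>R (x0 - x)) + norm x"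
        by (metis add_diff_cancel_left' norm_triangle_ineq4)
      ultimately show False using B(2)[OF ray[OF \<open>0 \<le> t\<close>]] B(2)[OF \<open>x \<in> P\<close>] by linarith
    qed
    then obtain u where "u \<in> U" "u \<notin> T x" by (auto simp: T_def)
    then have "T x \<subseteq> U - {u}" by (auto simp: T_def)
    moreover have "card (U - {u}) \<le> card (T x)"
      using \<open>u \<in> U\<close> assms(1) \<open>DIM('a) \<le> card (T x)\<close> finite_normals by simp
    ultimately have "T x = U - {u}" using finite_normals by (meson card_seteq finite_Diff)
    then show ?thesis using \<open>u \<in> U\<close> by blast
  qed
  have "finite E" unfolding E_eq by (rule finite_extreme_points_hpoly[OF finite_normals])
  have "card E = card (T ` E)" using inj by (simp add: card_image)
  also have "\<dots> \<le> card ((\<lambda>u. U - {u}) ` U)"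
    using T finite_normals by (intro card_mono) auto
  also have "\<dots> \<le> card U" using finite_normals by (rule card_image_le)
  finally have "card E \<le> DIM('a) + 1" using assms(1) by simp
  have "aff_dim E = int DIM('a)" using assms(2) aff_dim_convex_hull[of E] hull by simp
  moreover have "aff_dim E \<le> int (card E) - 1" using aff_dim_le_card[OF \<open>finite E\<close>] by simp
  ultimately have card: "int (card E) = int DIM('a) + 1" using \<open>card E \<le> _\<close> by linarith
  then have "\<not> affine_dependent E"
    using \<open>finite E\<close> \<open>aff_dim E = _\<close> by (simp add: affine_independent_iff_card)
  then show ?thesis using hull card by (auto simp: simplex_def)
qed

section \<open>Minkowski summands with the same facet normals\<close>

text \<open>
Boundedness depends only on the normals: a contraction towards \<open>x0\<close> maps the polyhedron into \<open>P\<close>.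
\<close>

lemma bounded_hpoly: "bounded (hpoly U b)"
proof -
  have "\<exists>r>0. \<forall>u\<in>U. r \<le> h u - x0 \<bullet> u"
    by (rule finite_positive_lower_bound[OF finite_normals]) (use strict in auto)
  then obtain r where r: "0 < r" "\<And>u. u \<in> U \<Longrightarrow> r \<le> h u - x0 \<bullet> u" by blast
  obtain M0 where "\<And>u. u \<in> U \<Longrightarrow> b u - h u \<le> M0"
    using bdd_above_finite[OF finite_imageI[OF finite_normals], of "\<lambda>u. b u - h u"] by (auto simp: bdd_above_def)
  then obtain M where M: "0 \<le> M" "\<And>u. u \<in> U \<Longrightarrow> b u \<le> h u + M"
    by (metis add.commute diff_le_eq linear order_trans add_left_mono)
  obtain B where B: "\<And>y. y \<in> P \<Longrightarrow> norm y \<le> B"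
    using compact_imp_bounded[OF compact_P] by (auto simp: bounded_iff)
  define s where "s = r / (r + M)"
  have s: "0 < s" using r M by (simp add: s_def)
  have "norm x \<le> norm x0 + (B + norm x0) / s" if x: "x \<in> hpoly U b" for x
  proof -
    have "x0 + s *\<^sub>R (x - x0) \<in> P"
      unfolding mem_P_iff
    proof
      fix u assume u: "u \<in> U"
      have "x \<bullet> u - x0 \<bullet> u \<le> h u - x0 \<bullet> u + M" using x M(2)[OF u] u by (force simp: hpoly_def)
      then have "s * (x \<bullet> u - x0 \<bullet> u) \<le> s * (h u - x0 \<bullet> u + M)" using s by simp
      also have "\<dots> \<le> h u - x0 \<bullet> u"
      proof -
        have "r * M \<le> (h u - x0 \<bullet> u) * M" using r(2)[OF u] M(1) by (rule mult_right_mono)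
        then show ?thesis using r M by (simp add: s_def field_simps)
      qed
      finally show "(x0 + s *\<^sub>R (x - x0)) \<bullet> u \<le> h u" by (simp add: inner_add_left inner_diff_left)
    qed
    then have "norm (x0 + s *\<^sub>R (x - x0)) \<le> B" by (rule B)
    then have "norm (s *\<^sub>R (x - x0)) \<le> B + norm x0"
      using norm_triangle_ineq4[of "x0 + s *\<^sub>R (x - x0)" x0] by simp
    then have "s * norm (x - x0) \<le> B + norm x0" using s by (simp only: norm_scaleR abs_of_pos)
    then have "norm (x - x0) \<le> (B + norm x0) / s" using s by (simp add: pos_le_divide_eq mult.commute)
    then show ?thesis using norm_triangle_sub[of x x0] by linarith
  qed
  then show ?thesis unfolding bounded_iff by blast
qed

lemma compact_hpoly: "compact (hpoly U b)"
  by (simp add: compact_eq_bounded_closed bounded_hpoly closed_hpoly)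

text \<open>
There are finitely many candidate sets \<open>J\<close> of tight constraints. If \<open>J\<close> is not jointly tight anywhere on
\<open>P\<close>, then the total violation \<open>g\<close> of the conditions "\<open>x \<in> P\<close> and \<open>J\<close> is tight at \<open>x\<close>" is positive
everywhere, hence bounded below by a positive constant on a compact set. But \<open>g\<close> is at most a
multiple of \<open>\<epsilon>\<close> at a point of the perturbed polytope where \<open>J\<close> is tight.
\<close>

lemma small_perturbation_refines:
  assumes c: "\<And>u. u \<in> U \<Longrightarrow> 0 \<le> c u" "\<And>u. u \<in> U \<Longrightarrow> c u \<le> 1"
  shows "eventually (\<lambda>\<epsilon>. \<forall>x\<in>hpoly U (\<lambda>u. h u + \<epsilon> * c u). 
    \<exists>v\<in>P. \<forall>u\<in>U. x \<bullet> u = h u + \<epsilon> * c u \<longrightarrow> v \<bullet> u = h u) (at_right 0)"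
proof -
  have "eventually (\<lambda>\<epsilon>. \<forall>x\<in>hpoly U (\<lambda>u. h u + \<epsilon> * c u). 
      {u \<in> U. x \<bullet> u = h u + \<epsilon> * c u} = J \<longrightarrow> (\<exists>v\<in>P. \<forall>u\<in>J. v \<bullet> u = h u)) (at_right 0)"
    if J: "J \<in> Pow U" for J
  proof (cases "\<exists>v\<in>P. \<forall>u\<in>J. v \<bullet> u = h u")
    case False
    define g where "g x = (\<Sum>u\<in>U. max 0 (x \<bullet> u - h u)) + (\<Sum>u\<in>J. \<bar>x \<bullet> u - h u\<bar>)" for x
    define C where "C = hpoly U (\<lambda>u. h u + 1)"
    have "finite J" using J finite_normals finite_subset by blast
    have g_pos: "0 < g x" for x
    proof (rule ccontr)
      assume "\<not> 0 < g x"
      moreover have "0 \<le> (\<Sum>u\<in>U. max 0 (x \<bullet> u - h u))" "0 \<le> (\<Sum>u\<in>J. \<bar>x \<bullet> u - h u\<bar>)"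
        by (auto intro: sum_nonneg)
      ultimately have "(\<Sum>u\<in>U. max 0 (x \<bullet> u - h u)) = 0" "(\<Sum>u\<in>J. \<bar>x \<bullet> u - h u\<bar>) = 0"
        unfolding g_def by linarith+
      then have "\<forall>u\<in>U. max 0 (x \<bullet> u - h u) = 0" "\<forall>u\<in>J. x \<bullet> u = h u"
        using finite_normals \<open>finite J\<close> by (simp_all add: sum_nonneg_eq_0_iff)
      then have "x \<in> P" "\<forall>u\<in>J. x \<bullet> u = h u" by (auto simp: mem_P_iff max_def split: if_splits)
      then show False using False by blast
    qed
    have "x0 \<in> C" using x0_in_P by (force simp: C_def hpoly_def mem_P_iff)
    then have "C \<noteq> {}" "compact C" unfolding C_def using compact_hpoly by auto
    moreover have "continuous_on C g" unfolding g_def by (intro continuous_intros)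
    ultimately obtain y where y: "y \<in> C" "\<And>x. x \<in> C \<Longrightarrow> g y \<le> g x"
      using continuous_attains_inf by metis
    define N where "N = real (card U) + real (card J)"
    have "((\<lambda>\<epsilon>. N * \<epsilon>) \<longlongrightarrow> N * 0) (at_right 0)" by (intro tendsto_intros)
    then have "eventually (\<lambda>\<epsilon>. N * \<epsilon> < g y) (at_right 0)"
      using g_pos[of y] by (intro order_tendstoD) auto
    moreover have "eventually (\<lambda>\<epsilon>::real. \<epsilon> < 1) (at_right 0)"
      by (intro order_tendstoD[OF tendsto_ident_at]) simp
    moreover have "eventually (\<lambda>\<epsilon>::real. 0 < \<epsilon>) (at_right 0)" by (rule eventually_at_right_less)
    ultimately show ?thesis
    proof eventually_elim
      case (elim \<epsilon>)
      have False if x: "x \<in> hpoly U (\<lambda>u. h u + \<epsilon> * c u)" "{u \<in> U. x \<bullet> u = h u + \<epsilon> * c u} = J" for x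
      proof -
        have \<epsilon>c: "0 \<le> \<epsilon> * c u" "\<epsilon> * c u \<le> \<epsilon>" if "u \<in> U" for u
          using elim c[OF that] by (auto simp: mult_le_cancel_left1)
        have le: "x \<bullet> u \<le> h u + \<epsilon>" if "u \<in> U" for u
        proof -
          have "x \<bullet> u \<le> h u + \<epsilon> * c u" using x(1) that by (simp add: hpoly_def)
          then show ?thesis using \<epsilon>c[OF that] by linarith
        qed
        have "x \<bullet> u \<le> h u + 1" if "u \<in> U" for u
          using le[OF that] elim by linarith
        then have "x \<in> C" by (simp add: C_def hpoly_def)
        have "max 0 (x \<bullet> u - h u) \<le> \<epsilon>" if "u \<in> U" for u
          using le[OF that] elim by linarith
        then have "(\<Sum>u\<in>U. max 0 (x \<bullet> u - h u)) \<le> (\<Sum>u\<in>U. \<epsilon>)" by (rule sum_mono)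
        moreover have "\<bar>x \<bullet> u - h u\<bar> \<le> \<epsilon>" if "u \<in> J" for u
        proof -
          have "u \<in> U" "x \<bullet> u = h u + \<epsilon> * c u" using x(2) that by blast+
          then show ?thesis using \<epsilon>c[of u] by linarith
        qed
        then have "(\<Sum>u\<in>J. \<bar>x \<bullet> u - h u\<bar>) \<le> (\<Sum>u\<in>J. \<epsilon>)" by (rule sum_mono)
        ultimately have "g x \<le> N * \<epsilon>" by (simp add: g_def N_def algebra_simps)
        then show False using y(2)[OF \<open>x \<in> C\<close>] elim by linarith
      qed
      then show ?case by blast
    qed
  qed simp
  then have "eventually (\<lambda>\<epsilon>. \<forall>J\<in>Pow U. \<forall>x\<in>hpoly U (\<lambda>u. h u + \<epsilon> * c u). 
      {u \<in> U. x \<bullet> u = h u + \<epsilon> * c u} = J \<longrightarrow> (\<exists>v\<in>P. \<forall>u\<in>J. v \<bullet> u = h u)) (at_right 0)"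
    using finite_normals by (intro eventually_ball_finite) auto
  then show ?thesis
  proof eventually_elim
    case (elim \<epsilon>)
    show ?case
    proof
      fix x assume "x \<in> hpoly U (\<lambda>u. h u + \<epsilon> * c u)"
      then have "\<exists>v\<in>P. \<forall>u\<in>{u \<in> U. x \<bullet> u = h u + \<epsilon> * c u}. v \<bullet> u = h u"
        using elim by blast
      then show "\<exists>v\<in>P. \<forall>u\<in>U. x \<bullet> u = h u + \<epsilon> * c u \<longrightarrow> v \<bullet> u = h u" by blast
    qed
  qed
qed

text \<open>
For an extreme point \<open>x\<close> of \<open>Q = hpoly U b\<close> pick \<open>v x \<in> P\<close> with at least the same tight constraints. Then \<open>l x - v x\<close>
satisfies the constraints of the complementary summand: where \<open>x\<close> is tight this is an equality, and
elsewhere \<open>x\<close> has positive slack, which \<open>l\<close> multiplies beyond any bound. So \<open>P + M\<close> contains \<open>l x\<close> for each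
extreme point \<open>x\<close>, and by convexity all of \<open>l Q\<close>.
\<close>

lemma summand_if_refines:
  assumes refines: "\<And>x. x \<in> hpoly U b \<Longrightarrow> \<exists>v\<in>P. \<forall>u\<in>U. x \<bullet> u = b u \<longrightarrow> v \<bullet> u = h u"
  shows "eventually (\<lambda>l. P + hpoly U (\<lambda>u. l * b u - h u) = hpoly U (\<lambda>u. l * b u)) at_top"
proof -
  define E where "E = {x. x extreme_point_of hpoly U b}"
  have "finite E" unfolding E_def by (rule finite_extreme_points_hpoly[OF finite_normals])
  have hull: "hpoly U b = convex hull E"
    unfolding E_def by (intro Krein_Milman_Minkowski compact_hpoly convex_hpoly)
  have E_sub: "x \<in> hpoly U b" if "x \<in> E" for x using that by (simp add: E_def extreme_point_of_def)
  obtain v where v: "\<And>x. x \<in> hpoly U b \<Longrightarrow> v x \<in> P" "\<And>x u. x \<in> hpoly U b \<Longrightarrow> u \<in> U \<Longrightarrow> x \<bullet> u = b u \<Longrightarrow> v x \<bullet> u = h u"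
    using refines by metis
  have "eventually (\<lambda>l. h u - v x \<bullet> u \<le> l * (b u - x \<bullet> u)) at_top" if "x \<in> E" "u \<in> U" for x u
  proof (cases "x \<bullet> u = b u")
    case True
    then show ?thesis using v(2)[OF E_sub[OF that(1)] that(2)] by simp
  next
    case False
    then have gap: "0 < b u - x \<bullet> u" using E_sub[OF that(1)] that(2) by (force simp: hpoly_def)
    show ?thesis
      using eventually_ge_at_top[of "(h u - v x \<bullet> u) / (b u - x \<bullet> u)"]
      by (rule eventually_mono) (use gap in \<open>simp add: field_simps\<close>)
  qed
  then have "eventually (\<lambda>l. \<forall>x\<in>E. \<forall>u\<in>U. h u - v x \<bullet> u \<le> l * (b u - x \<bullet> u)) at_top"
    using \<open>finite E\<close> finite_normals by (intro eventually_ball_finite ballI) auto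
  then show ?thesis
    using eventually_gt_at_top[of 0]
  proof eventually_elim
    case (elim l)
    let ?M = "hpoly U (\<lambda>u. l * b u - h u)" and ?K = "hpoly U (\<lambda>u. l * b u)"
    show ?case
    proof
      show "P + ?M \<subseteq> ?K"
      proof
        fix x assume "x \<in> P + ?M"
        then obtain p m where "x = p + m" "p \<in> P" "m \<in> ?M" by (rule set_plus_elim)
        then show "x \<in> ?K" by (fastforce simp: hpoly_def mem_P_iff inner_add_left)
      qed
      define S where "S = (\<lambda>q. l *\<^sub>R q) -` (P + ?M)"
      have "linear ((*\<^sub>R) l :: 'a \<Rightarrow> 'a)" by (rule linear_scaleR)
      moreover have "convex P" by (metis P_eq convex_hpoly)
      ultimately have "convex S"
        unfolding S_def by (intro convex_linear_vimage convex_set_plus convex_hpoly)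
      moreover have "E \<subseteq> S"
      proof
        fix x assume x: "x \<in> E"
        have "l *\<^sub>R x - v x \<in> ?M"
          using elim x by (auto simp: hpoly_def inner_diff_left algebra_simps)
        then have "v x + (l *\<^sub>R x - v x) \<in> P + ?M"
          using v(1)[OF E_sub[OF x]] by (intro set_plus_intro)
        then show "x \<in> S" by (simp add: S_def)
      qed
      ultimately have "hpoly U b \<subseteq> S" unfolding hull by (intro hull_minimal)
      show "?K \<subseteq> P + ?M"
      proof
        fix x assume "x \<in> ?K"
        then have "x /\<^sub>R l \<in> hpoly U b" using elim by (simp add: hpoly_def field_simps)
        then have "l *\<^sub>R (x /\<^sub>R l) \<in> P + ?M" using \<open>hpoly U b \<subseteq> S\<close> unfolding S_def by blast
        then show "x \<in> P + ?M" using elim by simp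
      qed
    qed
  qed
qed

text \<open>
Push the facet with normal \<open>j\<close> outwards and let \<open>M\<close> be the complementary summand, so that \<open>P + M = K\<close>
is a dilate of the pushed polytope. By indecomposability \<open>M = k P + z\<close>, so \<open>K\<close> has support function
\<open>(1 + k) h + z\<close>. At the other normals \<open>K\<close> has the support values of \<open>l P\<close>, and at \<open>j\<close> a strictly larger
one. The difference of the two expressions is the claimed functional.
\<close>

lemma indecomposable_imp_dual_functional:
  assumes "j \<in> U" "convex_body P" "\<not> weakly_decomposable P"
  shows "\<exists>\<alpha> z \<delta>. \<delta> \<noteq> 0 \<and> (\<forall>u\<in>U. \<alpha> * h u + z \<bullet> u = (if u = j then \<delta> else 0))"
proof -
  define c where "c u = (if u = j then 1 else 0 :: real)" for u
  have "eventually (\<lambda>\<epsilon>. (\<forall>x\<in>hpoly U (\<lambda>u. h u + \<epsilon> * c u). 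
    \<exists>v\<in>P. \<forall>u\<in>U. x \<bullet> u = h u + \<epsilon> * c u \<longrightarrow> v \<bullet> u = h u) \<and> 0 < \<epsilon>) (at_right 0)"
    by (intro eventually_conj small_perturbation_refines eventually_at_right_less) (auto simp: c_def)
  then obtain \<epsilon> where "0 < \<epsilon>" and refines: "\<And>x. x \<in> hpoly U (\<lambda>u. h u + \<epsilon> * c u) \<Longrightarrow> 
    \<exists>v\<in>P. \<forall>u\<in>U. x \<bullet> u = h u + \<epsilon> * c u \<longrightarrow> v \<bullet> u = h u"
    using eventually_happens'[OF trivial_limit_at_right_real] by blast
  define b where "b u = h u + \<epsilon> * c u" for u
  have "eventually (\<lambda>l. P + hpoly U (\<lambda>u. l * b u - h u) = hpoly U (\<lambda>u. l * b u) \<and> 0 < l) at_top"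
    using refines unfolding b_def
    by (intro eventually_conj summand_if_refines eventually_gt_at_top) auto
  then obtain l where l: "P + hpoly U (\<lambda>u. l * b u - h u) = hpoly U (\<lambda>u. l * b u)" "0 < l"
    using eventually_happens'[OF trivial_limit_at_top_linorder] by blast
  define M where "M = hpoly U (\<lambda>u. l * b u - h u)"
  define K where "K = hpoly U (\<lambda>u. l * b u)"
  have PM: "P + M = K" using l by (simp add: M_def K_def)
  have hb: "h u \<le> b u" for u using \<open>0 < \<epsilon>\<close> by (simp add: b_def c_def)
  have scaled: "l *\<^sub>R p \<in> K" if "p \<in> hpoly U b" for p
    using that \<open>0 < l\<close> by (simp add: K_def hpoly_def)
  have P_sub: "p \<in> hpoly U b" if "p \<in> P" for p
    using that hb by (force simp: hpoly_def mem_P_iff intro: order_trans)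
  have "K \<noteq> {}" using scaled[OF P_sub[OF x0_in_P]] by blast
  then have "M \<noteq> {}" using PM by (auto simp: set_plus_def)
  moreover have "compact M" "convex M" unfolding M_def by (rule compact_hpoly convex_hpoly)+
  moreover have "absolutely_continuous (surface_area_measure P) (surface_area_measure (P + M))"
  proof -
    have "(l *\<^sub>R x0) \<bullet> u < l * b u" if "u \<in> U" for u
      using strict[OF that] hb[of u] \<open>0 < l\<close> by simp
    then show ?thesis unfolding PM K_def by (intro absolutely_continuous_same_normals compact_hpoly)
  qed
  ultimately have "homothetic M P" using assms by (auto simp: weakly_decomposable_def)
  then obtain k z where k: "0 \<le> k" "M = (\<lambda>y. k *\<^sub>R y + z) ` P" by (auto simp: homothetic_def)
  have "P \<noteq> {}" using x0_in_P by blast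
  have hK: "support_function K u = (1 + k) * h u + z \<bullet> u" for u
  proof -
    obtain p where p: "p \<in> P" "p \<bullet> u = h u" "\<And>y. y \<in> P \<Longrightarrow> y \<bullet> u \<le> h u"
      using support_function_attained[OF compact_P \<open>P \<noteq> {}\<close>] by metis
    have "p + (k *\<^sub>R p + z) \<in> K" unfolding PM[symmetric] k(2) using p(1) by (intro set_plus_intro) auto
    moreover have "(p + (k *\<^sub>R p + z)) \<bullet> u = (1 + k) * h u + z \<bullet> u"
      using p(2) by (simp add: inner_add_left algebra_simps)
    moreover have "y \<bullet> u \<le> (1 + k) * h u + z \<bullet> u" if y: "y \<in> K" for y
    proof -
      obtain q q' where q: "y = q + (k *\<^sub>R q' + z)" "q \<in> P" "q' \<in> P"
        using y unfolding PM[symmetric] k(2) by (auto elim!: set_plus_elim)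
      have "k * (q' \<bullet> u) \<le> k * h u" using p(3)[OF q(3)] k(1) by (rule mult_left_mono)
      then show ?thesis using p(3)[OF q(2)] by (simp add: q(1) inner_add_left algebra_simps)
    qed
    ultimately show ?thesis by (rule support_function_eqI)
  qed
  have K_other: "support_function K u = l * h u" if "u \<in> U" "u \<noteq> j" for u
  proof -
    obtain p where p: "p \<in> P" "p \<bullet> u = h u"
      using support_function_attained[OF compact_P \<open>P \<noteq> {}\<close>] by metis
    show ?thesis
    proof (rule support_function_eqI)
      show "l *\<^sub>R p \<in> K" by (rule scaled[OF P_sub[OF p(1)]])
      show "(l *\<^sub>R p) \<bullet> u = l * h u" using p by simp
      show "y \<bullet> u \<le> l * h u" if "y \<in> K" for y
        using that \<open>u \<in> U\<close> \<open>u \<noteq> j\<close> by (auto simp: K_def hpoly_def b_def c_def)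
    qed
  qed
  have K_j: "l * h j < support_function K j"
  proof -
    obtain p where p: "p \<bullet> j = h j" "\<And>u. u \<in> U - {j} \<Longrightarrow> p \<bullet> u < h u"
      using facet_point[OF assms(1)] by blast
    have jj: "j \<bullet> j = 1" using unit_normals[OF assms(1)] by (simp add: norm_eq_1)
    have "\<exists>r>0. \<forall>u\<in>U - {j}. r \<le> h u - p \<bullet> u"
      by (rule finite_positive_lower_bound) (use finite_normals p(2) in auto)
    then obtain r where r: "0 < r" "\<And>u. u \<in> U - {j} \<Longrightarrow> r \<le> h u - p \<bullet> u" by blast
    define s where "s = min r \<epsilon>"
    have s: "0 < s" "s \<le> r" "s \<le> \<epsilon>" using r \<open>0 < \<epsilon>\<close> by (auto simp: s_def)
    have "p + s *\<^sub>R j \<in> hpoly U b"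
    proof -
      have "(p + s *\<^sub>R j) \<bullet> u \<le> b u" if "u \<in> U" for u
      proof (cases "u = j")
        case True
        then show ?thesis using s p(1) jj by (simp add: b_def c_def inner_add_left)
      next
        case False
        have "j \<bullet> u \<le> 1" using norm_cauchy_schwarz[of j u] unit_normals that assms(1) by simp
        then have "s * (j \<bullet> u) \<le> s" using mult_left_mono[of "j \<bullet> u" 1 s] s(1) by simp
        moreover have "r \<le> h u - p \<bullet> u" using r(2) that False by blast
        ultimately have "p \<bullet> u + s * (j \<bullet> u) \<le> b u" using s(2) hb[of u] by linarith
        then show ?thesis by (simp add: inner_add_left)
      qed
      then show ?thesis by (simp add: hpoly_def)
    qed
    then have "(l *\<^sub>R (p + s *\<^sub>R j)) \<bullet> j \<le> support_function K j"
      by (intro support_function_ge scaled) (simp_all add: K_def compact_hpoly)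
    moreover have "(l *\<^sub>R (p + s *\<^sub>R j)) \<bullet> j = l * h j + l * s"
      using p(1) jj by (simp add: inner_add_left algebra_simps)
    ultimately show ?thesis using s(1) \<open>0 < l\<close> by (smt (verit) mult_pos_pos)
  qed
  show ?thesis
  proof (intro exI conjI ballI)
    show "support_function K j - l * h j \<noteq> 0" using K_j by simp
    show "(1 + k - l) * h u + z \<bullet> u = (if u = j then support_function K j - l * h j else 0)" if "u \<in> U" for u
      using hK[of u] K_other[OF that] by (auto simp: algebra_simps)
  qed
qed

text \<open>
The functionals of the preceding lemma form, up to scaling, a dual family for the vectors
\<open>(h u, u)\<close>, which are therefore linearly independent in a space of dimension \<open>n + 1\<close>.
\<close>

lemma card_normals_le_if_indecomposable:
  assumes "convex_body P" "\<not> weakly_decomposable P"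
  shows "card U \<le> DIM('a) + 1"
proof -
  define f where "f u = (h u, u)" for u
  have "inj_on f U" by (auto simp: f_def inj_on_def)
  have "independent (f ` U)"
    unfolding dependent_def
  proof (rule notI, elim bexE)
    fix a assume "a \<in> f ` U" and span: "a \<in> span (f ` U - {a})"
    then obtain j where j: "j \<in> U" "a = f j" by blast
    obtain \<alpha> z \<delta> where "\<delta> \<noteq> 0" and dual: "\<And>u. u \<in> U \<Longrightarrow> \<alpha> * h u + z \<bullet> u = (if u = j then \<delta> else 0)"
      using indecomposable_imp_dual_functional[OF j(1) assms] by blast
    have "orthogonal (\<alpha>, z) w" if "w \<in> f ` U - {a}" for w
      using that dual j by (auto simp: orthogonal_def f_def split: if_splits)
    then have "orthogonal (\<alpha>, z) a"
      using span orthogonal_to_span by blast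
    then show False using dual[OF j(1)] \<open>\<delta> \<noteq> 0\<close> by (simp add: j(2) orthogonal_def f_def)
  qed
  then have "card (f ` U) \<le> DIM(real \<times> 'a)" using independent_bound by blast
  then show ?thesis using card_image[OF \<open>inj_on f U\<close>] by simp
qed

end

theorem proposition5p6:
  fixes P :: "'a::euclidean_space set"
  assumes "polytope P" and "aff_dim P = int DIM('a)"
    and "\<not> int DIM('a) simplex P"
  shows "weakly_decomposable P"
proof (rule ccontr)
  assume "\<not> weakly_decomposable P"
  have "P \<noteq> {}" using assms(2) by auto
  then have "interior P \<noteq> {}"
    using assms rel_interior_eq_empty[OF polytope_imp_convex[OF assms(1)]]
    by (simp add: interior_rel_interior_gen)
  then have "convex_body P"
    using assms(1) by (simp add: convex_body_def polytope_imp_convex polytope_imp_compact)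
  obtain U x0 where "facet_presentation P U x0"
    using facet_presentation_exists assms by blast
  then interpret facet_presentation P U x0 .
  have "card U \<le> DIM('a) + 1"
    using \<open>convex_body P\<close> \<open>\<not> weakly_decomposable P\<close> by (rule card_normals_le_if_indecomposable)
  then show False using simplex_if_few_normals assms by blast
qed

end
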